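(* Let $K$ be a field and let $A=\bigoplus_{i=0}^d A_i$ be a standard graded Artinian Gorenstein algebra over $A_0=K$ with socle degree $d$. Assume that the characteristic of $K$ is zero or greater than $d$. Let $B=\bigoplus_{i=0}^d B_i$ be a graded $K$-subalgebra of $A$ such that $B_1\subset A_1$, $B=K[B_1]$, and $B$ is Gorenstein with the same socle degree $d$ as $A$. Then a Macaulay dual generator for $B$ is obtained from that of $A$ by substitution by linear forms; that is, for a Macaulay dual generator $F(x_1,\ldots,x_n)$ for $A$ there is a Macaulay dual generator $G(y_1,\ldots,y_m)$ for $B$ which is obtained from $F$ by substitution by linear forms.
   Context: Standard graded means $A_0=K$ and $A=K[A_1]$, with $A_1$ finite-dimensional. The socle degree of a graded Artinian Gorenstein algebra is its largest degree $d$ with nonzero component. Let $R=K[x_1,\ldots,x_n]$ with all variables of degree $1$, and $R_d$ its homogeneous component of degree $d$. $R$ acts on itself by $f\circ F=f\left(\frac{\partial}{\partial x_1},\ldots,\frac{\partial}{\partial x_n}\right)F$. For $F\in R_d$ put $\mathrm{Ann}_R(F)=\{f\in R\mid f\circ F=0\}$. A homogeneous polynomial $F\in R_d$ is a Macaulay dual generator for a standard graded Artinian Gorenstein algebra $A$ of socle degree $d$ if $A\cong R/\mathrm{Ann}_R(F)$ as graded $K$-algebras (and similarly for $B$ with the polynomial ring $K[y_1,\ldots,y_m]$). Given polynomials $F=F(x_1,\ldots,x_n)$ and $G=G(y_1,\ldots,y_m)$ in independent sets of variables, $G$ is said to be obtained from $F$ by substitution by linear forms if there exists a full rank $m\times n$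 matrix $M=(m_{ij})$ over $K$ such that $F(x_1,\ldots,x_n)=G(y_1,\ldots,y_m)$ after the substitution $(x_1\ x_2\ \cdots\ x_n)=(y_1\ y_2\ \cdots\ y_m)M$, i.e. $G(y_1,\ldots,y_m)=F\left(\sum_{i=1}^m m_{i1}y_i,\ldots,\sum_{i=1}^m m_{in}y_i\right)$. *)

theory Defs
  imports
    "HOL-Library.Poly_Mapping"
    "HOL-Algebra.QuotRing"
    "HOL-Algebra.Subrings"
    "Jordan_Normal_Form.DL_Rank"
begin

section \<open>Graded algebras over a field\<close>

text \<open>
  The ground field is a type \<open>'k\<close> of class \<^class>\<open>field\<close>, seen as the ring record
  \<^term>\<open>class_ring :: 'k::field ring\<close>. A \<open>'k\<close>-algebra is a record satisfying the locale
  \<^locale>\<open>algebra\<close> over it, and a subalgebra (or a subspace) with underlying set \<open>S\<close> is the record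
  \<open>A\<lparr>carrier := S\<rparr>\<close>.
\<close>

locale graded_algebra =
  algebra class_ring A for A :: "('k::field, 'a) module" +
  fixes gr :: "nat \<Rightarrow> 'a set"
  assumes gr_submodule: "submodule class_ring (gr i) A"
    and gr_decomposition: "a \<in> carrier A \<Longrightarrow>
      \<exists>!c. (\<forall>i. c i \<in> gr i) \<and> finite {i. c i \<noteq> \<zero>\<^bsub>A\<^esub>}
         \<and> a = (\<Oplus>\<^bsub>A\<^esub>i\<in>{i. c i \<noteq> \<zero>\<^bsub>A\<^esub>}. c i)"
    and gr_one: "\<one>\<^bsub>A\<^esub> \<in> gr 0"
    and gr_mult: "x \<in> gr i \<Longrightarrow> y \<in> gr j \<Longrightarrow> x \<otimes>\<^bsub>A\<^esub> y \<in> gr (i + j)"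

definition is_subalgebra :: "'a set \<Rightarrow> ('k::field, 'a) module \<Rightarrow> bool" where
  "is_subalgebra C A \<longleftrightarrow> subring C A \<and> submodule class_ring C A"

text \<open>The subalgebra \<open>K[S]\<close> generated by \<open>S\<close>.\<close>

definition generated_subalgebra :: "('k::field, 'a) module \<Rightarrow> 'a set \<Rightarrow> 'a set" where
  "generated_subalgebra A S = \<Inter>{C. is_subalgebra C A \<and> S \<subseteq> C}"

definition graded_subalgebra ::
    "('k::field, 'a) module \<Rightarrow> (nat \<Rightarrow> 'a set) \<Rightarrow> 'a set \<Rightarrow> (nat \<Rightarrow> 'a set) \<Rightarrow> bool" where
  "graded_subalgebra A gr B grB \<longleftrightarrow>
     is_subalgebra B A \<and> graded_algebra (A\<lparr>carrier := B\<rparr>) grB \<and> (\<forall>i. grB i \<subseteq> gr i)"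

text \<open>The first two axioms say that \<open>c \<mapsto> c \<odot> \<one>\<close> is a bijection from \<open>K\<close> onto \<open>A\<^sub>0\<close>.\<close>

locale standard_graded_algebra = graded_algebra A gr
  for A :: "('k::field, 'a) module" and gr :: "nat \<Rightarrow> 'a set" +
  assumes nontrivial: "\<one>\<^bsub>A\<^esub> \<noteq> \<zero>\<^bsub>A\<^esub>"
    and gr_0: "gr 0 = {c \<odot>\<^bsub>A\<^esub> \<one>\<^bsub>A\<^esub> | c. True}"
    and generated: "carrier A = generated_subalgebra A (gr 1)"
    and fin_dim_gr_1: "vectorspace.fin_dim class_ring (A\<lparr>carrier := gr 1\<rparr>)"

definition artinian_ring :: "('a, 'm) ring_scheme \<Rightarrow> bool" where
  "artinian_ring R \<longleftrightarrow> ring R \<and>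
     (\<forall>I :: nat \<Rightarrow> 'a set. (\<forall>n. ideal (I n) R) \<and> (\<forall>n. I (Suc n) \<subseteq> I n)
        \<longrightarrow> (\<exists>N. \<forall>n\<ge>N. I n = I N))"

text \<open>
  The socle is the annihilator of the maximal ideal. For an algebra with \<open>A\<^sub>0 = K\<close> the homogeneous
  maximal ideal is the sum of the \<open>A\<^sub>i\<close> with \<open>i > 0\<close>, and its annihilator is that of the
  union of these \<open>A\<^sub>i\<close>. Such an Artinian algebra is Gorenstein if its socle is one-dimensional.
  The finiteness clause is needed because \<^const>\<open>vectorspace.dim\<close> is meaningful only for
  finite-dimensional spaces.
\<close>

definition graded_socle :: "('k, 'a) module \<Rightarrow> (nat \<Rightarrow> 'a set) \<Rightarrow> 'a set" where
  "graded_socle A gr = {a \<in> carrier A. \<forall>i>0. \<forall>x\<in>gr i. a \<otimes>\<^bsub>A\<^esub> x = \<zero>\<^bsub>A\<^esub>}"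

definition artinian_gorenstein :: "('k::field, 'a) module \<Rightarrow> (nat \<Rightarrow> 'a set) \<Rightarrow> bool" where
  "artinian_gorenstein A gr \<longleftrightarrow> artinian_ring A
     \<and> vectorspace.fin_dim class_ring (A\<lparr>carrier := graded_socle A gr\<rparr>)
     \<and> vectorspace.dim class_ring (A\<lparr>carrier := graded_socle A gr\<rparr>) = 1"

definition has_socle_degree :: "('k, 'a) module \<Rightarrow> (nat \<Rightarrow> 'a set) \<Rightarrow> nat \<Rightarrow> bool" where
  "has_socle_degree A gr d \<longleftrightarrow> gr d \<noteq> {\<zero>\<^bsub>A\<^esub>} \<and> (\<forall>i>d. gr i = {\<zero>\<^bsub>A\<^esub>})"

definition graded_algebra_iso ::
    "('k, 'a) module \<Rightarrow> (nat \<Rightarrow> 'a set) \<Rightarrow> ('k, 'b) module \<Rightarrow> (nat \<Rightarrow> 'b set) \<Rightarrow> ('a \<Rightarrow> 'b) set" where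
  "graded_algebra_iso A gr A' gr' =
     {h \<in> ring_iso A A'. (\<forall>c. \<forall>x\<in>carrier A. h (c \<odot>\<^bsub>A\<^esub> x) = c \<odot>\<^bsub>A'\<^esub> h x) \<and> (\<forall>i. h ` gr i = gr' i)}"

text \<open>The ring quotient, with scalars acting on cosets in the same style as \<^const>\<open>rcoset_mult\<close>.\<close>

definition quotient_algebra :: "('k, 'a) module \<Rightarrow> 'a set \<Rightarrow> ('k, 'a set) module" where
  "quotient_algebra A I =
     ring.extend (A Quot I) (module.fields (\<lambda>c X. \<Union>x\<in>X. I +>\<^bsub>A\<^esub> (c \<odot>\<^bsub>A\<^esub> x)))"

definition quotient_grading :: "('k, 'a) module \<Rightarrow> 'a set \<Rightarrow> (nat \<Rightarrow> 'a set) \<Rightarrow> nat \<Rightarrow> 'a set set" where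
  "quotient_grading A I gr i = (\<lambda>x. I +>\<^bsub>A\<^esub> x) ` gr i"


section \<open>Polynomials\<close>

text \<open>
  Polynomials in countably many variables, with variables indexed from \<open>0\<close>; the polynomial ring in
  \<open>n\<close> variables consists of those in which only the variables with index \<open>< n\<close> occur.
\<close>

type_synonym 'k mpol = "(nat \<Rightarrow>\<^sub>0 nat) \<Rightarrow>\<^sub>0 'k"

definition const_pol :: "'k::field \<Rightarrow> 'k mpol" where
  "const_pol c = Poly_Mapping.single 0 c"

definition var_pol :: "nat \<Rightarrow> 'k::field mpol" where
  "var_pol i = Poly_Mapping.single (Poly_Mapping.single i 1) 1"

definition polynomial_algebra :: "nat \<Rightarrow> ('k::field, 'k mpol) module" where
  "polynomial_algebra n =
     \<lparr>carrier = {p. \<forall>u\<in>Poly_Mapping.keys p. Poly_Mapping.keys u \<subseteq> {..<n}},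
      mult = (*), one = 1, zero = 0, add = (+), smult = (\<lambda>c p. const_pol c * p)\<rparr>"

definition monomial_degree :: "(nat \<Rightarrow>\<^sub>0 nat) \<Rightarrow> nat" where
  "monomial_degree u = (\<Sum>i\<in>Poly_Mapping.keys u. Poly_Mapping.lookup u i)"

definition homogeneous_component :: "nat \<Rightarrow> nat \<Rightarrow> 'k::field mpol set" where
  "homogeneous_component n d =
     {p \<in> carrier (polynomial_algebra n). \<forall>u\<in>Poly_Mapping.keys p. monomial_degree u = d}"

definition partial_deriv :: "nat \<Rightarrow> 'k::field mpol \<Rightarrow> 'k mpol" where
  "partial_deriv i p = (\<Sum>u\<in>Poly_Mapping.keys p.
     Poly_Mapping.single (u - Poly_Mapping.single i 1)
       (of_nat (Poly_Mapping.lookup u i) * Poly_Mapping.lookup p u))"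

text \<open>
  The operator obtained from the monomial \<open>x\<^sup>u\<close> by replacing each \<open>x\<^sub>i\<close> by the \<open>i\<close>-th partial
  derivative, and the action of a polynomial by the resulting differential operator with
  constant coefficients. The partial derivatives commute, so the order of composition is immaterial.
\<close>

definition monomial_action :: "(nat \<Rightarrow>\<^sub>0 nat) \<Rightarrow> 'k::field mpol \<Rightarrow> 'k mpol" where
  "monomial_action u =
     fold (\<lambda>i. partial_deriv i ^^ Poly_Mapping.lookup u i) (sorted_list_of_set (Poly_Mapping.keys u))"

definition diff_action :: "'k::field mpol \<Rightarrow> 'k mpol \<Rightarrow> 'k mpol" where
  "diff_action f F =
     (\<Sum>u\<in>Poly_Mapping.keys f. const_pol (Poly_Mapping.lookup f u) * monomial_action u F)"

definition Ann :: "nat \<Rightarrow> 'k::field mpol \<Rightarrow> 'k mpol set" where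
  "Ann n F = {f \<in> carrier (polynomial_algebra n). diff_action f F = 0}"

definition macaulay_dual_generator ::
    "('k::field, 'a) module \<Rightarrow> (nat \<Rightarrow> 'a set) \<Rightarrow> nat \<Rightarrow> nat \<Rightarrow> 'k mpol \<Rightarrow> bool" where
  "macaulay_dual_generator A gr d n F \<longleftrightarrow>
     F \<in> homogeneous_component n d \<and>
     graded_algebra_iso A gr
       (quotient_algebra (polynomial_algebra n) (Ann n F))
       (quotient_grading (polynomial_algebra n) (Ann n F) (homogeneous_component n)) \<noteq> {}"

definition substitute :: "(nat \<Rightarrow> 'k::field mpol) \<Rightarrow> 'k mpol \<Rightarrow> 'k mpol" where
  "substitute s p = (\<Sum>u\<in>Poly_Mapping.keys p.
     const_pol (Poly_Mapping.lookup p u) * (\<Prod>i\<in>Poly_Mapping.keys u. s i ^ Poly_Mapping.lookup u i))"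

text \<open>
  \<open>F\<close> is a polynomial in \<open>n\<close> variables and \<open>G\<close> one in \<open>m\<close> variables. Full rank means rank
  \<open>min m n\<close>. For \<open>j \<ge> n\<close> the linear form substituted is irrelevant as \<open>x\<^sub>j\<close> does not occur in \<open>F\<close>.
\<close>

definition obtained_by_linear_substitution ::
    "nat \<Rightarrow> 'k::field mpol \<Rightarrow> nat \<Rightarrow> 'k mpol \<Rightarrow> bool" where
  "obtained_by_linear_substitution n F m G \<longleftrightarrow>
     (\<exists>M \<in> carrier_mat m n. vec_space.rank m M = min m n \<and>
        G = substitute (\<lambda>j. \<Sum>i<m. const_pol (M $$ (i, j)) * var_pol i) F)"

end

theory Submission
  imports Defs
begin

text \<open>
Write \<open>R = K[x\<^sub>1,\<dots>,x\<^sub>n]\<close> and let \<open>\<theta> : R \<rightarrow> A\<close> be the surjection with kernel \<open>Ann F\<close> that the dual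
generator \<open>F\<close> provides. Linear forms \<open>\<ell>\<^sub>1,\<dots>,\<ell>\<^sub>m\<close> of \<open>R\<close> whose images span \<open>B\<^sub>1\<close> define
\<open>\<psi> : S = K[y\<^sub>1,\<dots>,y\<^sub>m] \<rightarrow> R\<close>, \<open>y\<^sub>i \<mapsto> \<ell>\<^sub>i = \<Sum>\<^sub>j M\<^sub>i\<^sub>j x\<^sub>j\<close>, and \<open>\<theta> \<circ> \<psi>\<close> maps \<open>S\<close> onto \<open>B\<close>, because \<open>B\<close> is
generated by \<open>B\<^sub>1\<close>. The polynomial \<open>G\<close> is \<open>\<sigma> F\<close>, where \<open>\<sigma> : R \<rightarrow> S\<close> is the transposed substitution
\<open>x\<^sub>j \<mapsto> \<Sum>\<^sub>i M\<^sub>i\<^sub>j y\<^sub>i\<close>. What has to be shown is that \<open>\<theta> \<circ> \<psi>\<close> has kernel \<open>Ann G\<close>.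

Let \<open>g \<circ> F\<close> denote the result of applying the operator \<open>g\<close> to \<open>F\<close>. The chain rule
(\<open>diff_action_linear_substitution\<close>) reads \<open>g \<circ> \<sigma> F = \<sigma> (\<psi> g \<circ> F)\<close>, so the kernel is contained
in \<open>Ann G\<close>. The map \<open>\<sigma>\<close> need not be injective, and the converse inclusion is where the
Gorenstein property of \<open>B\<close> and the equality of socle degrees enter. If \<open>g\<close> has a nonzero image in \<open>B\<close>,
some multiple of that image is a nonzero element of the socle \<open>B\<^sub>d\<close>
(\<open>gorenstein_multiple_in_top_degree\<close>), hence the image of some \<open>h \<in> S\<^sub>d\<close>. As \<open>F\<close> has degree \<open>d\<close>, the
polynomial \<open>\<psi> h \<circ> F\<close> is a constant, it is nonzero, and \<open>\<sigma>\<close> fixes constants; so \<open>h\<close>, and with it \<open>g\<close>,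
does not annihilate \<open>G\<close> (\<open>annihilator_of_substitution\<close>).

The rank condition is met by a choice of the \<open>\<ell>\<^sub>i\<close>: they form a basis, in reduced echelon form, of
the space of all linear forms with image in \<open>B\<^sub>1\<close> (\<open>reduced_basis\<close>), so that \<open>M\<close> contains an identity
matrix of size \<open>m\<close>. Their images in \<open>B\<^sub>1\<close> may be linearly dependent, which does no harm: then
\<open>Ann G\<close> contains linear forms.

Isomorphisms with a quotient algebra are traded for surjections from the polynomial ring with
prescribed kernel (\<open>graded_algebra_iso_quotient_iff\<close>), which are easier to compose and restrict.
\<close>

section \<open>Monomials and polynomials\<close>

lemma monomial_degree_eq_sum:
  assumes "finite S" "Poly_Mapping.keys u \<subseteq> S"
  shows "monomial_degree u = (\<Sum>i\<in>S. Poly_Mapping.lookup u i)"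
  unfolding monomial_degree_def
  by (rule sum.mono_neutral_left) (use assms in \<open>auto simp: in_keys_iff\<close>)

lemma keys_add_nat:
  fixes u v :: "nat \<Rightarrow>\<^sub>0 nat"
  shows "Poly_Mapping.keys (u + v) = Poly_Mapping.keys u \<union> Poly_Mapping.keys v"
  by (auto simp: in_keys_iff lookup_add)

lemma monomial_degree_add: "monomial_degree (u + v) = monomial_degree u + monomial_degree v"
proof -
  let ?S = "Poly_Mapping.keys u \<union> Poly_Mapping.keys v"
  have "monomial_degree (u + v) = (\<Sum>i\<in>?S. Poly_Mapping.lookup (u + v) i)"
    by (rule monomial_degree_eq_sum) (auto simp: keys_add_nat)
  also have "\<dots> = monomial_degree u + monomial_degree v"
    by (simp add: lookup_add sum.distrib monomial_degree_eq_sum [of ?S])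
  finally show ?thesis .
qed

lemma monomial_degree_single [simp]: "monomial_degree (Poly_Mapping.single i e) = e"
  by (cases "e = 0") (simp_all add: monomial_degree_def)

lemma monomial_split_var:
  fixes u :: "nat \<Rightarrow>\<^sub>0 nat"
  assumes "i \<in> Poly_Mapping.keys u"
  shows "u = Poly_Mapping.single i 1 + (u - Poly_Mapping.single i 1)"
  using assms
  by (intro poly_mapping_eqI) (auto simp: lookup_add lookup_minus lookup_single when_def in_keys_iff)

lemma monomial_induct [case_names one var]:
  assumes one: "P 0"
    and var: "\<And>i u. P u \<Longrightarrow> P (Poly_Mapping.single i 1 + u)"
  shows "P (u :: nat \<Rightarrow>\<^sub>0 nat)"
proof (induction "monomial_degree u" arbitrary: u)
  case 0
  then have "Poly_Mapping.lookup u i = 0" for i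
    by (cases "i \<in> Poly_Mapping.keys u") (auto simp: monomial_degree_def in_keys_iff)
  then have "u = 0"
    by (intro poly_mapping_eqI) simp
  then show ?case using one by simp
next
  case (Suc e)
  then have "Poly_Mapping.keys u \<noteq> {}"
    by (auto simp: monomial_degree_def)
  then obtain i where i: "i \<in> Poly_Mapping.keys u" by blast
  define v where "v = u - Poly_Mapping.single i 1"
  have u: "u = Poly_Mapping.single i 1 + v"
    unfolding v_def by (rule monomial_split_var [OF i])
  with Suc.hyps(2) have "e = monomial_degree v"
    by (simp add: monomial_degree_add)
  then show ?case
    unfolding u using Suc.hyps(1) by (intro var)
qed

lemma sum_single_lookup:
  "(\<Sum>u\<in>Poly_Mapping.keys p. Poly_Mapping.single u (Poly_Mapping.lookup p u)) = p"
  by (rule poly_mapping_eqI)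
     (simp add: lookup_sum lookup_single when_def sum.delta' in_keys_iff)

lemma single_induct [case_names zero single add]:
  fixes p :: "'a \<Rightarrow>\<^sub>0 'b::comm_monoid_add"
  assumes zero: "P 0"
    and single: "\<And>u c. u \<in> Poly_Mapping.keys p \<Longrightarrow> P (Poly_Mapping.single u c)"
    and add: "\<And>p q. P p \<Longrightarrow> P q \<Longrightarrow> P (p + q)"
  shows "P p"
proof -
  have "P (\<Sum>u\<in>S. Poly_Mapping.single u (Poly_Mapping.lookup p u))"
    if "finite S" "S \<subseteq> Poly_Mapping.keys p" for S
    using that by (induction S rule: finite_induct) (auto intro: assms)
  from this [of "Poly_Mapping.keys p"] show ?thesis
    by (simp add: sum_single_lookup)
qed

lemma const_pol_0 [simp]: "const_pol 0 = 0"
  and const_pol_1 [simp]: "const_pol 1 = 1"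
  and const_pol_mult_single: "const_pol a * Poly_Mapping.single u b = Poly_Mapping.single u (a * b)"
  and const_pol_mult: "const_pol (a * b) = const_pol a * const_pol b"
  and const_pol_add: "const_pol (a + b) = const_pol a + const_pol b"
  and const_pol_uminus: "const_pol (- a) = - const_pol a"
  by (simp_all add: const_pol_def mult_single single_add single_uminus)

lemma const_pol_eq_0_iff [simp]: "const_pol c = 0 \<longleftrightarrow> c = 0"
  by (metis const_pol_def const_pol_0 lookup_single_eq lookup_zero)

lemma var_pol_mult_single:
  "var_pol i * Poly_Mapping.single u c = Poly_Mapping.single (Poly_Mapping.single i 1 + u) c"
  by (simp add: var_pol_def mult_single)

lemma mem_polynomial_algebra:
  "p \<in> carrier (polynomial_algebra n) \<longleftrightarrow>
    (\<forall>u\<in>Poly_Mapping.keys p. Poly_Mapping.keys u \<subseteq> {..<n})"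
  by (simp add: polynomial_algebra_def)

lemma zero_mem [simp]: "0 \<in> carrier (polynomial_algebra n)"
  and const_mem [simp]: "const_pol c \<in> carrier (polynomial_algebra n)"
  and var_mem: "i < n \<Longrightarrow> var_pol i \<in> carrier (polynomial_algebra n)"
  by (auto simp: mem_polynomial_algebra const_pol_def var_pol_def split: if_splits)

lemma one_mem [simp]: "1 \<in> carrier (polynomial_algebra n)"
  by (metis const_mem const_pol_1)

lemma add_mem:
  "p \<in> carrier (polynomial_algebra n) \<Longrightarrow> q \<in> carrier (polynomial_algebra n)
    \<Longrightarrow> p + q \<in> carrier (polynomial_algebra n)"
  unfolding mem_polynomial_algebra using keys_add [of p q] by blast

lemma mult_mem:
  "p \<in> carrier (polynomial_algebra n) \<Longrightarrow> q \<in> carrier (polynomial_algebra n)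
    \<Longrightarrow> p * q \<in> carrier (polynomial_algebra n)"
  unfolding mem_polynomial_algebra using keys_mult [of p q]
  by (fastforce simp: keys_add_nat)

lemma sum_mem:
  "(\<And>x. x \<in> S \<Longrightarrow> f x \<in> carrier (polynomial_algebra n))
    \<Longrightarrow> (\<Sum>x\<in>S. f x) \<in> carrier (polynomial_algebra n)"
  by (induction S rule: infinite_finite_induct) (auto intro: add_mem)

text \<open>
A polynomial ring is generated by constants and variables; this rule and its homogeneous version
below replace computations with coefficients in most later proofs.
\<close>

lemma polynomial_algebra_induct [consumes 1, case_names const add var_mult]:
  assumes p: "p \<in> carrier (polynomial_algebra n)"
    and const: "\<And>c. P (const_pol c)"
    and add: "\<And>p q. P p \<Longrightarrow> P q \<Longrightarrow> P (p + q)"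
    and var_mult: "\<And>i p. i < n \<Longrightarrow> P p \<Longrightarrow> P (var_pol i * p)"
  shows "P p"
proof (induction p rule: single_induct)
  case zero
  then show ?case using const [of 0] by simp
next
  case (single u c)
  then have "Poly_Mapping.keys u \<subseteq> {..<n}"
    using p by (simp add: mem_polynomial_algebra)
  then show ?case
  proof (induction u rule: monomial_induct)
    case one
    then show ?case using const [of c] by (simp add: const_pol_def)
  next
    case (var i u)
    then show ?case
      using var_mult [of i "Poly_Mapping.single u c"] by (simp add: keys_add_nat var_pol_mult_single)
  qed
qed (rule add)

lemma mpol_induct [case_names const add var_mult]:
  assumes "\<And>c. P (const_pol c)"
    and "\<And>p q. P p \<Longrightarrow> P q \<Longrightarrow> P (p + q)"
    and "\<And>i p. P p \<Longrightarrow> P (var_pol i * p)"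
  shows "P (p :: 'k::field mpol)"
proof -
  have "finite (\<Union>u\<in>Poly_Mapping.keys p. Poly_Mapping.keys u)" by simp
  then obtain n where "(\<Union>u\<in>Poly_Mapping.keys p. Poly_Mapping.keys u) \<subseteq> {..<n}"
    by (metis finite_nat_iff_bounded)
  then have "p \<in> carrier (polynomial_algebra n)"
    by (auto simp: mem_polynomial_algebra)
  then show ?thesis
    by (induction p rule: polynomial_algebra_induct) (use assms in auto)
qed

lemma homogeneous_componentD:
  "p \<in> homogeneous_component n e \<Longrightarrow> p \<in> carrier (polynomial_algebra n)"
  by (simp add: homogeneous_component_def)

lemma homogeneous_component_induct [consumes 1, case_names const zero add var_mult]:
  assumes p: "p \<in> homogeneous_component n e"
    and const: "\<And>c. P 0 (const_pol c)"
    and zero: "\<And>e. P e 0"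
    and add: "\<And>e p q. P e p \<Longrightarrow> P e q \<Longrightarrow> P e (p + q)"
    and var_mult: "\<And>e i p. i < n \<Longrightarrow> P e p \<Longrightarrow> P (Suc e) (var_pol i * p)"
  shows "P e p"
proof (induction p rule: single_induct)
  case (single u c)
  then have "Poly_Mapping.keys u \<subseteq> {..<n}" "monomial_degree u = e"
    using p by (simp_all add: homogeneous_component_def mem_polynomial_algebra)
  then show ?case
  proof (induction u arbitrary: e rule: monomial_induct)
    case one
    then show ?case using const [of c] by (simp add: const_pol_def monomial_degree_def)
  next
    case (var i u)
    then show ?case
      using var_mult [of i "monomial_degree u" "Poly_Mapping.single u c"]
      by (auto simp: keys_add_nat var_pol_mult_single monomial_degree_add)
  qed
qed (auto intro: zero add)

lemma zero_homogeneous [simp]: "0 \<in> homogeneous_component n e"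
  and const_homogeneous [simp]: "const_pol c \<in> homogeneous_component n 0"
  and var_homogeneous: "i < n \<Longrightarrow> var_pol i \<in> homogeneous_component n 1"
  by (auto simp: homogeneous_component_def mem_polynomial_algebra const_pol_def var_pol_def
        monomial_degree_def)

lemma add_homogeneous:
  "p \<in> homogeneous_component n e \<Longrightarrow> q \<in> homogeneous_component n e
    \<Longrightarrow> p + q \<in> homogeneous_component n e"
  unfolding homogeneous_component_def using keys_add [of p q] by (auto intro: add_mem)

lemma sum_homogeneous:
  "(\<And>x. x \<in> S \<Longrightarrow> f x \<in> homogeneous_component n e)
    \<Longrightarrow> (\<Sum>x\<in>S. f x) \<in> homogeneous_component n e"
  by (induction S rule: infinite_finite_induct) (auto intro: add_homogeneous)

lemma mult_homogeneous:
  "p \<in> homogeneous_component n e \<Longrightarrow> q \<in> homogeneous_component n e'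
    \<Longrightarrow> p * q \<in> homogeneous_component n (e + e')"
  unfolding homogeneous_component_def using keys_mult [of p q]
  by (fastforce simp: monomial_degree_add intro: mult_mem)

lemma homogeneous_decomposition:
  assumes "p \<in> carrier (polynomial_algebra n)"
  obtains N :: nat and q
  where "\<And>e. q e \<in> homogeneous_component n e" and "p = (\<Sum>e<N. q e)"
proof
  define K where "K e = {u \<in> Poly_Mapping.keys p. monomial_degree u = e}" for e
  define N where "N = Suc (Max (monomial_degree ` Poly_Mapping.keys p))"
  let ?q = "\<lambda>e. \<Sum>u\<in>K e. Poly_Mapping.single u (Poly_Mapping.lookup p u)"
  show "?q e \<in> homogeneous_component n e" for e
    using assms
    by (intro sum_homogeneous)
       (auto simp: K_def homogeneous_component_def mem_polynomial_algebra split: if_splits)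
  have "p = (\<Sum>u\<in>Poly_Mapping.keys p. Poly_Mapping.single u (Poly_Mapping.lookup p u))"
    by (simp add: sum_single_lookup)
  also have "\<dots> = (\<Sum>e<N. ?q e)"
    unfolding K_def
    by (rule sum.group [symmetric]) (auto simp: N_def less_Suc_eq_le)
  finally show "p = (\<Sum>e<N. ?q e)" .
qed

lemma polynomial_algebra_simps [simp]:
  "mult (polynomial_algebra n) = (*)" "one (polynomial_algebra n) = 1"
  "zero (polynomial_algebra n) = 0" "add (polynomial_algebra n) = (+)"
  "smult (polynomial_algebra n) = (\<lambda>c p. const_pol c * p)"
  by (simp_all add: polynomial_algebra_def)

lemma uminus_mem:
  assumes "p \<in> carrier (polynomial_algebra n)"
  shows "- p \<in> carrier (polynomial_algebra n)"
proof -
  have "- p = const_pol (- 1) * p" by (simp add: const_pol_uminus)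
  then show ?thesis using mult_mem [OF const_mem assms] by metis
qed

lemma cring_polynomial_algebra: "cring (polynomial_algebra n :: ('k::field, 'k mpol) module)"
proof (intro cringI abelian_groupI comm_monoidI)
  fix p :: "'k mpol"
  assume "p \<in> carrier (polynomial_algebra n)"
  then show "\<exists>q\<in>carrier (polynomial_algebra n). q \<oplus>\<^bsub>polynomial_algebra n\<^esub> p = \<zero>\<^bsub>polynomial_algebra n\<^esub>"
    by (intro bexI [of _ "- p"]) (simp_all add: uminus_mem)
qed (auto simp: algebra_simps intro: add_mem mult_mem)

section \<open>Differential operators with constant coefficients\<close>

lemma partial_deriv_eq_sum:
  assumes "finite S" "Poly_Mapping.keys p \<subseteq> S"
  shows "partial_deriv i p = (\<Sum>u\<in>S. Poly_Mapping.single (u - Poly_Mapping.single i 1)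
       (of_nat (Poly_Mapping.lookup u i) * Poly_Mapping.lookup p u))"
  unfolding partial_deriv_def
  by (rule sum.mono_neutral_left) (use assms in \<open>auto simp: in_keys_iff\<close>)

lemma partial_deriv_single:
  "partial_deriv i (Poly_Mapping.single u c) =
    Poly_Mapping.single (u - Poly_Mapping.single i 1) (of_nat (Poly_Mapping.lookup u i) * c)"
  by (subst partial_deriv_eq_sum [of "{u}"]) auto

lemma partial_deriv_add: "partial_deriv i (p + q) = partial_deriv i p + partial_deriv i q"
proof -
  let ?S = "Poly_Mapping.keys p \<union> Poly_Mapping.keys q"
  show ?thesis
    by (subst (1 2 3) partial_deriv_eq_sum [of ?S])
       (use keys_add [of p q] in \<open>auto simp: lookup_add algebra_simps single_add sum.distrib\<close>)
qed

lemma partial_deriv_0 [simp]: "partial_deriv i 0 = 0"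
  by (simp add: partial_deriv_def)

lemma partial_deriv_const [simp]: "partial_deriv i (const_pol c) = 0"
  by (simp add: const_pol_def partial_deriv_single)

lemma partial_deriv_const_mult: "partial_deriv i (const_pol c * p) = const_pol c * partial_deriv i p"
  by (induction p rule: single_induct)
     (simp_all add: partial_deriv_add partial_deriv_single const_pol_mult_single algebra_simps)

lemma partial_deriv_sum: "partial_deriv i (\<Sum>x\<in>S. f x) = (\<Sum>x\<in>S. partial_deriv i (f x))"
  by (induction S rule: infinite_finite_induct) (simp_all add: partial_deriv_add)

text \<open>
The Leibniz rule for a product with a variable. Together with linearity and the
vanishing on constants it determines the derivation, so identities between derivatives follow from it by induction on polynomials.
\<close>

lemma partial_deriv_var_mult:
  "partial_deriv i (var_pol j * p) = (if i = j then p else 0) + var_pol j * partial_deriv i p"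
proof (induction p rule: single_induct)
  case (single u c)
  show ?case
  proof (cases "Poly_Mapping.lookup u i = 0")
    case True
    then show ?thesis
      by (auto simp: var_pol_mult_single partial_deriv_single lookup_add lookup_single when_def)
  next
    case False
    then have *: "Poly_Mapping.single j 1 + u - Poly_Mapping.single i 1 =
        Poly_Mapping.single j 1 + (u - Poly_Mapping.single i 1)"
      by (intro poly_mapping_eqI) (auto simp: lookup_add lookup_minus lookup_single when_def)
    have "i = j \<Longrightarrow> Poly_Mapping.single i 1 + (u - Poly_Mapping.single i 1) = u"
      using False by (intro monomial_split_var [symmetric]) (simp add: in_keys_iff)
    then show ?thesis
      by (auto simp: var_pol_mult_single partial_deriv_single lookup_add lookup_single when_def *
          distrib_right single_add simp del: One_nat_def)
  qed
qed (simp_all add: partial_deriv_add algebra_simps)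

lemma partial_deriv_commute: "partial_deriv i (partial_deriv j p) = partial_deriv j (partial_deriv i p)"
  by (induction p rule: mpol_induct)
     (auto simp: partial_deriv_add partial_deriv_var_mult partial_deriv_const_mult add_ac)

text \<open>
  The composition defining \<^const>\<open>monomial_action\<close> runs over the variables of \<open>u\<close> only; letting it
  run over a fixed initial segment makes the operators of different monomials comparable.
\<close>

lemma monomial_action_eq_fold:
  assumes "Poly_Mapping.keys u \<subseteq> {..<N}"
  shows "monomial_action u = fold (\<lambda>i. partial_deriv i ^^ Poly_Mapping.lookup u i) [0..<N]"
proof -
  have "Poly_Mapping.keys u = set (filter (\<lambda>i. i \<in> Poly_Mapping.keys u) [0..<N])"
    using assms by auto
  moreover have "sorted_list_of_set (set (filter (\<lambda>i. i \<in> Poly_Mapping.keys u) [0..<N])) =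
      filter (\<lambda>i. i \<in> Poly_Mapping.keys u) [0..<N]"
    by (rule sorted_list_of_set.idem_if_sorted_distinct) (simp_all add: sorted_wrt_filter)
  ultimately have "sorted_list_of_set (Poly_Mapping.keys u) =
      filter (\<lambda>i. i \<in> Poly_Mapping.keys u) [0..<N]"
    by simp
  then show ?thesis
    unfolding monomial_action_def
    by (auto simp: fold_filter fun_eq_iff in_keys_iff intro!: List.fold_cong)
qed

lemma monomial_action_0 [simp]: "monomial_action 0 p = p"
  by (simp add: monomial_action_def)

lemma partial_deriv_power_commute:
  "partial_deriv i ((partial_deriv j ^^ e) p) = (partial_deriv j ^^ e) (partial_deriv i p)"
  by (induction e) (simp_all add: partial_deriv_commute [of i j])

lemma partial_deriv_fold_commute:
  "partial_deriv i (fold (\<lambda>j. partial_deriv j ^^ f j) xs p) =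
    fold (\<lambda>j. partial_deriv j ^^ f j) xs (partial_deriv i p)"
  by (induction xs arbitrary: p) (simp_all add: partial_deriv_power_commute)

lemma monomial_action_var:
  "monomial_action (Poly_Mapping.single i 1 + u) p = partial_deriv i (monomial_action u p)"
proof -
  obtain N where N: "insert i (Poly_Mapping.keys u) \<subseteq> {..<N}"
    by (metis finite_insert finite_keys finite_nat_iff_bounded)
  have "fold (\<lambda>j. partial_deriv j ^^ Poly_Mapping.lookup (Poly_Mapping.single i 1 + u) j) xs p =
      (if i \<in> set xs then partial_deriv i else id) (fold (\<lambda>j. partial_deriv j ^^ Poly_Mapping.lookup u j) xs p)"
    if "distinct xs" for xs
    using that
    by (induction xs arbitrary: p)
       (auto simp: lookup_add lookup_single when_def partial_deriv_fold_commute
          partial_deriv_power_commute)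
  from this [of "[0..<N]"] show ?thesis
    using N by (simp add: monomial_action_eq_fold [of _ N] keys_add_nat)
qed

lemma monomial_action_add: "monomial_action u (p + q) = monomial_action u p + monomial_action u q"
  by (induction u rule: monomial_induct) (simp_all only: monomial_action_var monomial_action_0 partial_deriv_add)

lemma diff_action_eq_sum:
  assumes "finite S" "Poly_Mapping.keys f \<subseteq> S"
  shows "diff_action f F = (\<Sum>u\<in>S. const_pol (Poly_Mapping.lookup f u) * monomial_action u F)"
  unfolding diff_action_def
  by (rule sum.mono_neutral_left) (use assms in \<open>auto simp: in_keys_iff\<close>)

lemma diff_action_single: "diff_action (Poly_Mapping.single u c) F = const_pol c * monomial_action u F"
  by (subst diff_action_eq_sum [of "{u}"]) auto

lemma diff_action_add: "diff_action (f + g) F = diff_action f F + diff_action g F"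
proof -
  let ?S = "Poly_Mapping.keys f \<union> Poly_Mapping.keys g"
  show ?thesis
    by (subst (1 2 3) diff_action_eq_sum [of ?S])
       (use keys_add [of f g] in \<open>auto simp: lookup_add algebra_simps const_pol_add sum.distrib\<close>)
qed

lemma diff_action_0 [simp]: "diff_action 0 F = 0"
  by (simp add: diff_action_def)

lemma diff_action_const [simp]: "diff_action (const_pol c) F = const_pol c * F"
  by (simp add: const_pol_def [of c] diff_action_single)

lemma diff_action_add_right: "diff_action f (F + G) = diff_action f F + diff_action f G"
  by (simp add: diff_action_def monomial_action_add algebra_simps sum.distrib)

lemma diff_action_zero_right [simp]: "diff_action f 0 = 0"
  using diff_action_add_right [of f 0 0] by (metis add.right_neutral add_left_cancel)

lemma diff_action_const_mult: "diff_action (const_pol c * f) F = const_pol c * diff_action f F"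
  by (induction f rule: single_induct)
     (simp_all add: diff_action_single diff_action_add const_pol_mult_single const_pol_mult algebra_simps)

lemma diff_action_var_mult: "diff_action (var_pol i * f) F = partial_deriv i (diff_action f F)"
  by (induction f rule: single_induct)
     (simp_all add: var_pol_mult_single diff_action_single monomial_action_var partial_deriv_const_mult
        diff_action_add partial_deriv_add distrib_left del: One_nat_def)

lemma diff_action_mult: "diff_action (f * g) F = diff_action f (diff_action g F)"
  by (induction f rule: mpol_induct)
     (simp_all add: diff_action_const_mult diff_action_add diff_action_var_mult
        mult.assoc distrib_right)

lemma diff_action_uminus: "diff_action (- f) F = - diff_action f F"
  using diff_action_add [of f "- f" F] by (simp add: minus_unique)

lemma partial_deriv_homogeneous:
  assumes "p \<in> homogeneous_component n e"
  shows "partial_deriv i p \<in> homogeneous_component n (e - 1)"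
proof -
  \<comment> \<open>The middle clause makes the truncated \<open>e - 1\<close> harmless in degree \<open>0\<close>.\<close>
  from assms have "p \<in> homogeneous_component n e \<and> (e = 0 \<longrightarrow> partial_deriv i p = 0) \<and>
      partial_deriv i p \<in> homogeneous_component n (e - 1)"
  proof (induction p rule: homogeneous_component_induct)
    case (var_mult e j p)
    have "var_pol j * partial_deriv i p \<in> homogeneous_component n e"
    proof (cases "e = 0")
      case False
      with var_mult mult_homogeneous [OF var_homogeneous [of j n], of "partial_deriv i p" "e - 1"]
      show ?thesis by simp
    qed (use var_mult in simp)
    with var_mult mult_homogeneous [OF var_homogeneous [of j n], of p e] show ?case
      by (auto simp: partial_deriv_var_mult intro: add_homogeneous)
  qed (auto simp: partial_deriv_add intro: add_homogeneous)
  then show ?thesis by blast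
qed

lemma diff_action_homogeneous:
  assumes "f \<in> homogeneous_component m e'" and F: "F \<in> homogeneous_component n e"
  shows "diff_action f F \<in> homogeneous_component n (e - e')"
  using assms(1)
proof (induction f rule: homogeneous_component_induct)
  case (const c)
  then show ?case
    using mult_homogeneous [OF const_homogeneous F, of c] by simp
next
  case (var_mult e' i f)
  then show ?case
    using partial_deriv_homogeneous [of "diff_action f F" n "e - e'" i]
    by (simp add: diff_action_var_mult)
qed (auto simp: diff_action_add intro: add_homogeneous)

lemma homogeneous_component_0:
  assumes "p \<in> homogeneous_component n 0"
  obtains c where "p = const_pol c"
proof -
  have "e = 0 \<longrightarrow> (\<exists>c. p = const_pol c)" if "p \<in> homogeneous_component n e" for e
    using that
    by (induction p rule: homogeneous_component_induct)
       (auto intro: exI [of _ 0] simp flip: const_pol_add)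
  with assms that show thesis by blast
qed

lemma partial_deriv_mem:
  assumes "p \<in> carrier (polynomial_algebra n)"
  shows "partial_deriv i p \<in> carrier (polynomial_algebra n)"
proof -
  from assms have "p \<in> carrier (polynomial_algebra n) \<and> partial_deriv i p \<in> carrier (polynomial_algebra n)"
    by (induction p rule: polynomial_algebra_induct)
       (auto simp: partial_deriv_add partial_deriv_var_mult intro: add_mem mult_mem var_mem)
  then show ?thesis by blast
qed

lemma diff_action_mem:
  assumes F: "F \<in> carrier (polynomial_algebra n)"
  shows "diff_action f F \<in> carrier (polynomial_algebra n)"
  by (induction f rule: mpol_induct)
     (auto simp: diff_action_add diff_action_var_mult intro: partial_deriv_mem F add_mem mult_mem)

section \<open>Substitution and the chain rule\<close>

lemma substitute_eq_sum:
  assumes "finite S" "Poly_Mapping.keys p \<subseteq> S"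
  shows "substitute s p = (\<Sum>u\<in>S. const_pol (Poly_Mapping.lookup p u) *
    (\<Prod>i\<in>Poly_Mapping.keys u. s i ^ Poly_Mapping.lookup u i))"
  unfolding substitute_def
  by (rule sum.mono_neutral_left) (use assms in \<open>auto simp: in_keys_iff\<close>)

lemma substitute_single:
  assumes "finite S" "Poly_Mapping.keys u \<subseteq> S"
  shows "substitute s (Poly_Mapping.single u c) =
    const_pol c * (\<Prod>i\<in>S. s i ^ Poly_Mapping.lookup u i)"
proof -
  have "(\<Prod>i\<in>Poly_Mapping.keys u. s i ^ Poly_Mapping.lookup u i) =
      (\<Prod>i\<in>S. s i ^ Poly_Mapping.lookup u i)"
    by (rule prod.mono_neutral_left) (use assms in \<open>auto simp: in_keys_iff\<close>)
  then show ?thesis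
    by (subst substitute_eq_sum [of "{u}"]) auto
qed

lemma substitute_0 [simp]: "substitute s 0 = 0"
  by (simp add: substitute_def)

lemma substitute_const [simp]: "substitute s (const_pol c) = const_pol c"
  by (simp add: const_pol_def [of c] substitute_single [of "{}"])

lemma substitute_add: "substitute s (p + q) = substitute s p + substitute s q"
proof -
  let ?S = "Poly_Mapping.keys p \<union> Poly_Mapping.keys q"
  show ?thesis
    by (subst (1 2 3) substitute_eq_sum [of ?S])
       (use keys_add [of p q] in \<open>auto simp: lookup_add algebra_simps const_pol_add sum.distrib\<close>)
qed

lemma substitute_const_mult: "substitute s (const_pol c * p) = const_pol c * substitute s p"
proof (induction p rule: single_induct)
  case (single u b)
  then show ?case
    by (simp add: const_pol_mult_single substitute_single [of "Poly_Mapping.keys u"] const_pol_mult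
        mult.assoc)
qed (simp_all add: substitute_add distrib_left)

lemma substitute_var_mult: "substitute s (var_pol i * p) = s i * substitute s p"
proof (induction p rule: single_induct)
  case (single u c)
  let ?S = "insert i (Poly_Mapping.keys u)"
  have "(\<Prod>j\<in>?S. s j ^ Poly_Mapping.lookup (Poly_Mapping.single i 1 + u) j) =
      (\<Prod>j\<in>?S. if j = i then s j else 1) * (\<Prod>j\<in>?S. s j ^ Poly_Mapping.lookup u j)"
    unfolding prod.distrib [symmetric]
    by (rule prod.cong) (auto simp: lookup_add lookup_single when_def)
  also have "(\<Prod>j\<in>?S. if j = i then s j else 1) = s i"
    by (subst prod.delta) auto
  finally show ?case
    using substitute_single [of ?S u s c, OF _ subset_insertI]
      substitute_single [of ?S "Poly_Mapping.single i 1 + u" s c]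
    by (simp add: var_pol_mult_single keys_add_nat mult.left_commute del: One_nat_def)
qed (simp_all add: substitute_add distrib_left)

lemma substitute_mult: "substitute s (p * q) = substitute s p * substitute s q"
  by (induction p rule: mpol_induct)
     (simp_all add: substitute_const_mult substitute_add substitute_var_mult mult.assoc distrib_right)

lemma substitute_1 [simp]: "substitute s 1 = 1"
  by (metis const_pol_1 substitute_const)

lemma substitute_homogeneous:
  assumes "p \<in> homogeneous_component n e"
    and s: "\<And>i. i < n \<Longrightarrow> s i \<in> homogeneous_component m 1"
  shows "substitute s p \<in> homogeneous_component m e"
  using assms(1)
proof (induction p rule: homogeneous_component_induct)
  case (var_mult e i p)
  then show ?case
    using mult_homogeneous [OF s [of i] var_mult(2)] by (simp add: substitute_var_mult)
qed (auto simp: substitute_add intro: add_homogeneous)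

lemma substitute_mem:
  assumes "p \<in> carrier (polynomial_algebra n)"
    and s: "\<And>i. i < n \<Longrightarrow> s i \<in> carrier (polynomial_algebra m)"
  shows "substitute s p \<in> carrier (polynomial_algebra m)"
  using assms(1)
  by (induction p rule: polynomial_algebra_induct)
     (auto simp: substitute_add substitute_var_mult intro: add_mem mult_mem s)

definition linear_form :: "nat \<Rightarrow> (nat \<Rightarrow> 'k::field) \<Rightarrow> 'k mpol" where
  "linear_form n a = (\<Sum>i<n. const_pol (a i) * var_pol i)"

lemma linear_form_homogeneous: "linear_form n a \<in> homogeneous_component n 1"
  unfolding linear_form_def
proof (rule sum_homogeneous)
  fix i assume "i \<in> {..<n}"
  then show "const_pol (a i) * var_pol i \<in> homogeneous_component n 1"
    using mult_homogeneous [OF const_homogeneous var_homogeneous, of i n "a i"] by simp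
qed

lemma linear_form_mem: "linear_form n a \<in> carrier (polynomial_algebra n)"
  by (rule homogeneous_componentD [OF linear_form_homogeneous])

lemma linear_form_add: "linear_form n (\<lambda>i. a i + b i) = linear_form n a + linear_form n b"
  by (simp add: linear_form_def const_pol_add distrib_right sum.distrib)

lemma linear_form_scale: "linear_form n (\<lambda>i. c * a i) = const_pol c * linear_form n a"
  by (simp add: linear_form_def const_pol_mult sum_distrib_left mult.assoc)

lemma linear_form_sum:
  "linear_form n (\<lambda>i. \<Sum>j\<in>J. b j i) = (\<Sum>j\<in>J. linear_form n (b j))"
  by (induction J rule: infinite_finite_induct)
     (simp_all add: linear_form_add, simp_all add: linear_form_def)

lemma linear_form_cong: "(\<And>i. i < n \<Longrightarrow> a i = b i) \<Longrightarrow> linear_form n a = linear_form n b"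
  by (simp add: linear_form_def)

lemma substitute_sum: "substitute s (\<Sum>x\<in>S. f x) = (\<Sum>x\<in>S. substitute s (f x))"
  by (induction S rule: infinite_finite_induct) (simp_all add: substitute_add)

lemma substitute_linear_form: "substitute s (linear_form m a) = (\<Sum>i<m. const_pol (a i) * s i)"
proof -
  have "substitute s (var_pol i) = s i" for i
    using substitute_var_mult [of s i 1] by simp
  then show ?thesis
    by (simp add: linear_form_def substitute_sum substitute_const_mult)
qed

lemma substitute_cong:
  assumes "p \<in> carrier (polynomial_algebra n)" and "\<And>i. i < n \<Longrightarrow> s i = t i"
  shows "substitute s p = substitute t p"
  using assms(1)
  by (induction p rule: polynomial_algebra_induct)
     (simp_all add: substitute_add substitute_var_mult assms(2))

lemma homogeneous_component_1:
  assumes "p \<in> homogeneous_component n 1"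
  obtains a where "p = linear_form n a"
proof -
  have "e = 1 \<longrightarrow> (\<exists>a. p = linear_form n a)" if "p \<in> homogeneous_component n e" for e
  proof -
    have "p \<in> homogeneous_component n e \<and> (e = 1 \<longrightarrow> (\<exists>a. p = linear_form n a))"
      using that
    proof (induction p rule: homogeneous_component_induct)
      case (zero e)
      have "0 = linear_form n (\<lambda>_. 0 :: 'a)" by (simp add: linear_form_def)
      then show ?case by auto
    next
      case (add e p q)
      then show ?case by (auto intro: add_homogeneous simp flip: linear_form_add)
    next
      case (var_mult e i p)
      have "\<exists>a. var_pol i * p = linear_form n a" if "e = 0"
      proof -
        from that var_mult obtain c where p: "p = const_pol c"
          by (metis homogeneous_component_0)
        have "linear_form n (\<lambda>j. if j = i then c else 0) =
            (\<Sum>j<n. if j = i then const_pol c * var_pol j else 0)"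
          unfolding linear_form_def by (rule sum.cong) auto
        also have "\<dots> = var_pol i * p"
          using var_mult p by (simp add: mult.commute)
        finally show ?thesis by metis
      qed
      then show ?case
        using var_mult mult_homogeneous [OF var_homogeneous [of i n], of p e] by simp
    qed simp
    then show ?thesis by blast
  qed
  with assms that show thesis by blast
qed

lemma partial_deriv_linear_form_mult:
  assumes "i < m"
  shows "partial_deriv i (linear_form m a * p) = const_pol (a i) * p + linear_form m a * partial_deriv i p"
proof -
  have "partial_deriv i (linear_form m a * p) =
      (\<Sum>j<m. const_pol (a j) * ((if i = j then p else 0) + var_pol j * partial_deriv i p))"
    by (simp add: linear_form_def sum_distrib_right partial_deriv_sum partial_deriv_const_mult mult.assoc
        partial_deriv_var_mult)
  also have "\<dots> = (\<Sum>j<m. if j = i then const_pol (a j) * p else 0) + linear_form m a * partial_deriv i p"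
    unfolding linear_form_def sum_distrib_right sum.distrib [symmetric]
    by (rule sum.cong) (auto simp: distrib_left mult.assoc)
  finally show ?thesis using assms by simp
qed

lemma diff_action_linear_form:
  "diff_action (linear_form n a) F = (\<Sum>j<n. const_pol (a j) * partial_deriv j F)"
proof -
  have sum: "diff_action (\<Sum>j\<in>S. f j) F = (\<Sum>j\<in>S. diff_action (f j) F)" for S and f :: "nat \<Rightarrow> 'a mpol"
    by (induction S rule: infinite_finite_induct) (simp_all add: diff_action_add)
  have var: "diff_action (var_pol j) F = partial_deriv j F" for j
    using diff_action_var_mult [of j 1 F] diff_action_const [of 1 F] by simp
  show ?thesis
    by (simp add: linear_form_def sum diff_action_const_mult var)
qed

lemma partial_deriv_linear_substitution:
  assumes "i < m" and "F \<in> carrier (polynomial_algebra n)"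
  shows "partial_deriv i (substitute (\<lambda>j. linear_form m (\<lambda>k. M k j)) F) =
    substitute (\<lambda>j. linear_form m (\<lambda>k. M k j)) (diff_action (linear_form n (M i)) F)"
  using assms(2)
proof (induction F rule: polynomial_algebra_induct)
  case (const c)
  then show ?case by (simp add: diff_action_linear_form)
next
  case (add p q)
  then show ?case by (simp add: substitute_add partial_deriv_add diff_action_add_right)
next
  case (var_mult j p)
  have "diff_action (linear_form n (M i)) (var_pol j * p) =
      (\<Sum>k<n. if k = j then const_pol (M i k) * p else 0) +
      var_pol j * diff_action (linear_form n (M i)) p"
    unfolding diff_action_linear_form sum_distrib_left sum.distrib [symmetric]
    by (rule sum.cong) (auto simp: partial_deriv_var_mult distrib_left mult.left_commute)
  also have "(\<Sum>k<n. if k = j then const_pol (M i k) * p else 0) = const_pol (M i j) * p"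
    using var_mult by simp
  finally show ?case
    using var_mult(2)
    by (simp add: substitute_var_mult substitute_add substitute_const_mult
        partial_deriv_linear_form_mult [OF assms(1)])
qed

text \<open>
The chain rule for linear substitutions, iterated: \<open>M\<close> acts on dual generators through its columns
and on differential operators through its rows. One derivative at a time this is
\<open>partial_deriv_linear_substitution\<close>, and the operators of both sides compose alike.
\<close>

theorem diff_action_linear_substitution:
  assumes "g \<in> carrier (polynomial_algebra m)" and F: "F \<in> carrier (polynomial_algebra n)"
  shows "diff_action g (substitute (\<lambda>j. linear_form m (\<lambda>i. M i j)) F) =
    substitute (\<lambda>j. linear_form m (\<lambda>i. M i j))
      (diff_action (substitute (\<lambda>i. linear_form n (M i)) g) F)"
  using assms(1)
proof (induction g rule: polynomial_algebra_induct)
  case (const c)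
  then show ?case by (simp add: substitute_const_mult)
next
  case (add p q)
  then show ?case by (simp add: substitute_add diff_action_add)
next
  case (var_mult i g)
  then show ?case
    using F by (simp add: substitute_var_mult diff_action_var_mult
        diff_action_mult [of "linear_form n (M i)"] partial_deriv_linear_substitution [where n = n] diff_action_mem)
qed

section \<open>Graded presentations\<close>

text \<open>
A surjection of graded algebras from the polynomial ring in \<open>n\<close> variables.
\<close>

definition graded_presentation ::
    "nat \<Rightarrow> ('k::field mpol \<Rightarrow> 'a) \<Rightarrow> ('k, 'a) module \<Rightarrow> (nat \<Rightarrow> 'a set) \<Rightarrow> bool" where
  "graded_presentation n \<theta> A gr \<longleftrightarrow>
     \<theta> \<in> Ring.ring_hom (polynomial_algebra n) A \<and>
     (\<forall>c. \<forall>f\<in>carrier (polynomial_algebra n). \<theta> (const_pol c * f) = c \<odot>\<^bsub>A\<^esub> \<theta> f) \<and>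
     \<theta> ` carrier (polynomial_algebra n) = carrier A \<and>
     (\<forall>i. \<theta> ` homogeneous_component n i = gr i)"

lemma graded_presentationD:
  assumes "graded_presentation n \<theta> A gr"
  shows "\<theta> \<in> Ring.ring_hom (polynomial_algebra n) A"
    and "f \<in> carrier (polynomial_algebra n) \<Longrightarrow> \<theta> (const_pol c * f) = c \<odot>\<^bsub>A\<^esub> \<theta> f"
    and "\<theta> ` carrier (polynomial_algebra n) = carrier A"
    and "\<theta> ` homogeneous_component n i = gr i"
  using assms by (auto simp: graded_presentation_def)

lemma polynomial_hom_simps:
  assumes "\<theta> \<in> Ring.ring_hom (polynomial_algebra n) A"
    and "f \<in> carrier (polynomial_algebra n)" "g \<in> carrier (polynomial_algebra n)"
  shows "\<theta> f \<in> carrier A" "\<theta> (f + g) = \<theta> f \<oplus>\<^bsub>A\<^esub> \<theta> g" "\<theta> (f * g) = \<theta> f \<otimes>\<^bsub>A\<^esub> \<theta> g"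
    "\<theta> 1 = \<one>\<^bsub>A\<^esub>"
  using assms ring_hom_closed ring_hom_add ring_hom_mult ring_hom_one
  by fastforce+

lemma quotient_algebra_simps [simp]:
  "carrier (quotient_algebra P I) = carrier (P Quot I)"
  "mult (quotient_algebra P I) = mult (P Quot I)"
  "one (quotient_algebra P I) = one (P Quot I)"
  "zero (quotient_algebra P I) = zero (P Quot I)"
  "add (quotient_algebra P I) = add (P Quot I)"
  "smult (quotient_algebra P I) = (\<lambda>c X. \<Union>x\<in>X. I +>\<^bsub>P\<^esub> (c \<odot>\<^bsub>P\<^esub> x))"
  by (simp_all add: quotient_algebra_def ring.defs module.defs)

lemma ring_hom_quotient_algebra:
  "Ring.ring_hom (quotient_algebra P I) A = Ring.ring_hom (P Quot I) A"
  "Ring.ring_hom A (quotient_algebra P I) = Ring.ring_hom A (P Quot I)"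
  by (simp_all add: Ring.ring_hom_def)

lemma ideal_Ann: "ideal (Ann n F) (polynomial_algebra n)"
proof -
  interpret P: cring "polynomial_algebra n :: ('a, 'a mpol) module"
    by (rule cring_polynomial_algebra)
  have minus: "\<ominus>\<^bsub>polynomial_algebra n\<^esub> f = - f" if "f \<in> carrier (polynomial_algebra n)" for f :: "'a mpol"
    using that by (intro P.minus_equality) (simp_all add: uminus_mem)
  show ?thesis
  proof (rule idealI)
    show "subgroup (Ann n F) (add_monoid (polynomial_algebra n))"
      by (rule P.add.subgroupI)
         (auto simp: Ann_def minus uminus_mem diff_action_uminus diff_action_add add_mem
           intro: exI [of _ 0] simp flip: a_inv_def)
    fix f g :: "'a mpol"
    assume "f \<in> Ann n F" "g \<in> carrier (polynomial_algebra n)"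
    then show "g \<otimes>\<^bsub>polynomial_algebra n\<^esub> f \<in> Ann n F"
      by (simp add: Ann_def diff_action_mult mult_mem)
    then show "f \<otimes>\<^bsub>polynomial_algebra n\<^esub> g \<in> Ann n F"
      by (simp add: mult.commute)
  qed (rule P.ring_axioms)
qed

text \<open>
Scalar multiplication on cosets is defined by a union over representatives; this makes all members
of that union equal.
\<close>

lemma rcoset_scale:
  assumes I: "ideal I (polynomial_algebra n)"
    and f: "f \<in> carrier (polynomial_algebra n)" and g: "g \<in> I +>\<^bsub>polynomial_algebra n\<^esub> f"
  shows "I +>\<^bsub>polynomial_algebra n\<^esub> (const_pol c * g) = I +>\<^bsub>polynomial_algebra n\<^esub> (const_pol c * f)"
proof -
  interpret I: ideal I "polynomial_algebra n" by (rule I)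
  obtain h where h: "h \<in> I" "g = h + f"
    using g by (auto simp: a_r_coset_def r_coset_def)
  have "const_pol c * h \<in> I"
    using I.I_l_closed [OF h(1), of "const_pol c"] by simp
  moreover have "const_pol c * f \<in> carrier (polynomial_algebra n)"
    using f by (simp add: mult_mem)
  ultimately have "const_pol c * g \<in> I +>\<^bsub>polynomial_algebra n\<^esub> (const_pol c * f)"
    using h by (auto simp: a_r_coset_def r_coset_def distrib_left)
  then show ?thesis
    using I.a_repr_independence \<open>const_pol c * f \<in> _\<close> I.a_subgroup
    by (metis I.a_repr_independence')
qed

lemma smult_rcoset:
  assumes I: "ideal I (polynomial_algebra n)"
    and f: "f \<in> carrier (polynomial_algebra n)"
  shows "c \<odot>\<^bsub>quotient_algebra (polynomial_algebra n) I\<^esub> (I +>\<^bsub>polynomial_algebra n\<^esub> f) =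
    I +>\<^bsub>polynomial_algebra n\<^esub> (const_pol c * f)"
proof -
  interpret I: ideal I "polynomial_algebra n" by (rule I)
  have "(\<Union>g\<in>I +>\<^bsub>polynomial_algebra n\<^esub> f. I +>\<^bsub>polynomial_algebra n\<^esub> (const_pol c * g)) =
      (\<Union>g\<in>I +>\<^bsub>polynomial_algebra n\<^esub> f. I +>\<^bsub>polynomial_algebra n\<^esub> (const_pol c * f))"
    by (rule SUP_cong [OF refl rcoset_scale [OF I f]])
  moreover have "f \<in> I +>\<^bsub>polynomial_algebra n\<^esub> f" by (rule I.a_rcos_self [OF f])
  ultimately show ?thesis by auto
qed

text \<open>
The homomorphism theorem in both directions. An isomorphism \<open>h\<close> onto the quotient gives the surjection
\<open>f \<mapsto> h\<^sup>-\<^sup>1(I + f)\<close>; a surjection \<open>\<theta>\<close> gives the isomorphism that sends \<open>b\<close> to its fibre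
\<open>\<theta>\<^sup>-\<^sup>1(b)\<close>, which is a coset of the kernel.
\<close>

lemma graded_algebra_iso_quotient_iff:
  assumes I: "ideal I (polynomial_algebra n)" and A: "graded_algebra A gr"
  shows "graded_algebra_iso A gr (quotient_algebra (polynomial_algebra n) I)
      (quotient_grading (polynomial_algebra n) I (homogeneous_component n)) \<noteq> {} \<longleftrightarrow>
    (\<exists>\<theta>. graded_presentation n \<theta> A gr \<and> {f \<in> carrier (polynomial_algebra n). \<theta> f = \<zero>\<^bsub>A\<^esub>} = I)"
    (is "?iso \<noteq> {} \<longleftrightarrow> _")
proof -
  let ?P = "polynomial_algebra n :: ('a, 'a mpol) module"
  interpret P: cring ?P by (rule cring_polynomial_algebra)
  interpret I: ideal I ?P by (rule I)
  interpret A: graded_algebra A gr by (rule A)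
  have coset: "I +>\<^bsub>?P\<^esub> f \<in> carrier (?P Quot I)" if "f \<in> carrier ?P" for f
    using that by (auto simp: FactRing_def A_RCOSETS_def RCOSETS_def a_r_coset_def)
  have hom_Q: "(+>\<^bsub>?P\<^esub>) I \<in> Ring.ring_hom ?P (?P Quot I)"
    by (rule I.rcos_ring_hom)
  show ?thesis
  proof
    assume "?iso \<noteq> {}"
    then obtain h where h: "h \<in> ring_iso A (quotient_algebra ?P I)"
      and h_smult: "\<And>c x. x \<in> carrier A \<Longrightarrow> h (c \<odot>\<^bsub>A\<^esub> x) = c \<odot>\<^bsub>quotient_algebra ?P I\<^esub> h x"
      and h_gr: "\<And>i. h ` gr i = (\<lambda>f. I +>\<^bsub>?P\<^esub> f) ` homogeneous_component n i"
      by (auto simp: graded_algebra_iso_def quotient_grading_def)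
    then have h': "h \<in> ring_iso A (?P Quot I)"
      by (simp add: ring_iso_def ring_hom_quotient_algebra)
    note bij = ring_iso_memE(5) [OF h']
    define k where "k = inv_into (carrier A) h"
    have k: "k \<in> ring_iso (?P Quot I) A"
      unfolding k_def by (rule ring_iso_set_sym [OF A.ring_axioms h'])
    have k_hom: "k \<in> Ring.ring_hom (?P Quot I) A"
      using k by (simp add: ring_iso_def)
    have hk: "h (k X) = X" if "X \<in> carrier (?P Quot I)" for X
      using bij that by (simp add: k_def f_inv_into_f bij_betw_def)
    have kh: "k (h x) = x" if "x \<in> carrier A" for x
      using bij that by (simp add: k_def bij_betw_def)
    define \<theta> where "\<theta> f = k (I +>\<^bsub>?P\<^esub> f)" for f
    have \<theta>_hom: "\<theta> \<in> Ring.ring_hom ?P A"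
      unfolding \<theta>_def
      by (rule ring_hom_memI)
         (use ring_hom_closed [OF k_hom] ring_hom_mult [OF k_hom] ring_hom_add [OF k_hom]
            ring_hom_one [OF k_hom] ring_hom_mult [OF hom_Q] ring_hom_add [OF hom_Q]
            ring_hom_one [OF hom_Q] coset in auto)
    have \<theta>_smult: "\<theta> (const_pol c * f) = c \<odot>\<^bsub>A\<^esub> \<theta> f" if f: "f \<in> carrier ?P" for c f
    proof -
      have \<theta>f: "\<theta> f \<in> carrier A"
        by (rule ring_hom_closed [OF \<theta>_hom f])
      have "h (c \<odot>\<^bsub>A\<^esub> \<theta> f) = c \<odot>\<^bsub>quotient_algebra ?P I\<^esub> (I +>\<^bsub>?P\<^esub> f)"
        unfolding h_smult [OF \<theta>f] by (simp only: \<theta>_def hk [OF coset [OF f]])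
      also have "\<dots> = I +>\<^bsub>?P\<^esub> (const_pol c * f)"
        by (rule smult_rcoset [OF I f])
      finally show ?thesis
        using kh [of "c \<odot>\<^bsub>A\<^esub> \<theta> f"] \<theta>f by (simp add: \<theta>_def)
    qed
    have "\<theta> ` carrier ?P = k ` carrier (?P Quot I)"
      by (auto simp: \<theta>_def FactRing_def A_RCOSETS_def RCOSETS_def a_r_coset_def)
    also have "\<dots> = carrier A"
      using ring_iso_memE(5) [OF k] by (simp add: bij_betw_def)
    finally have \<theta>_surj: "\<theta> ` carrier ?P = carrier A" .
    have \<theta>_gr: "\<theta> ` homogeneous_component n i = gr i" for i
    proof -
      have "\<theta> ` homogeneous_component n i = k ` h ` gr i"
        unfolding h_gr image_image \<theta>_def by (rule refl)
      also have "\<dots> = (\<lambda>x. x) ` gr i"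
        unfolding image_image
      proof (rule image_cong [OF refl kh])
        fix x assume "x \<in> gr i"
        then show "x \<in> carrier A"
          using A.gr_submodule [of i] by (auto simp: LinearCombinations.submodule_def)
      qed
      finally show ?thesis by simp
    qed
    interpret \<theta>: ring_hom_ring ?P A \<theta>
      by (rule ring_hom_ringI2 [OF P.ring_axioms A.ring_axioms \<theta>_hom])
    have "\<theta> f = \<zero>\<^bsub>A\<^esub> \<longleftrightarrow> f \<in> I" if f: "f \<in> carrier ?P" for f
    proof
      assume "f \<in> I"
      then have "I +>\<^bsub>?P\<^esub> f = I +>\<^bsub>?P\<^esub> 0"
        using I.a_rcos_const I.zero_closed by simp
      then show "\<theta> f = \<zero>\<^bsub>A\<^esub>"
        using \<theta>.hom_zero by (simp add: \<theta>_def)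
    next
      assume "\<theta> f = \<zero>\<^bsub>A\<^esub>"
      then have "\<theta> f = \<theta> 0" using \<theta>.hom_zero by simp
      then have "I +>\<^bsub>?P\<^esub> f = I +>\<^bsub>?P\<^esub> 0"
        unfolding \<theta>_def using hk [OF coset [OF f]] hk [OF coset [OF zero_mem]] by metis
      also have "\<dots> = I"
        using I.a_rcos_const I.zero_closed by simp
      finally show "f \<in> I"
        using I.a_rcos_self [OF f] by simp
    qed
    with \<theta>_hom \<theta>_smult \<theta>_surj \<theta>_gr
    show "\<exists>\<theta>. graded_presentation n \<theta> A gr \<and> {f \<in> carrier ?P. \<theta> f = \<zero>\<^bsub>A\<^esub>} = I"
      using I.a_subset by (intro exI [of _ \<theta>]) (auto simp: graded_presentation_def)
  next
    assume "\<exists>\<theta>. graded_presentation n \<theta> A gr \<and> {f \<in> carrier ?P. \<theta> f = \<zero>\<^bsub>A\<^esub>} = I"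
    then obtain \<theta> where pres: "graded_presentation n \<theta> A gr"
      and ker: "{f \<in> carrier ?P. \<theta> f = \<zero>\<^bsub>A\<^esub>} = I" by (elim exE conjE) (rule that)
    note \<theta> = graded_presentationD [OF pres]
    interpret \<theta>: ring_hom_ring ?P A \<theta>
      by (rule ring_hom_ringI2 [OF P.ring_axioms A.ring_axioms \<theta>(1)])
    have kernel: "a_kernel ?P A \<theta> = I"
      unfolding a_kernel_def kernel_def using ker by simp
    define H where "H b = {f \<in> carrier ?P. \<theta> f = b}" for b
    have H: "H (\<theta> f) = I +>\<^bsub>?P\<^esub> f" if "f \<in> carrier ?P" for f
      using \<theta>.rcos_eq_homeq [OF that] by (simp add: H_def kernel)
    have surj: "\<exists>f\<in>carrier ?P. b = \<theta> f" if "b \<in> carrier A" for b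
      using that unfolding \<theta>(3) [symmetric] by (rule imageE) blast
    have "H \<in> ring_iso A (quotient_algebra ?P I)"
    proof (rule ring_iso_memI)
      show "H b \<in> carrier (quotient_algebra ?P I)" if "b \<in> carrier A" for b
        using surj [OF that] H coset by auto
      show "H (b \<otimes>\<^bsub>A\<^esub> b') = H b \<otimes>\<^bsub>quotient_algebra ?P I\<^esub> H b'"
        if b: "b \<in> carrier A" and b': "b' \<in> carrier A" for b b'
      proof -
        obtain f f' where f: "f \<in> carrier ?P" "b = \<theta> f" "f' \<in> carrier ?P" "b' = \<theta> f'"
          using surj [OF b] surj [OF b'] by blast
        then show ?thesis
          using H [of "f * f'"] ring_hom_mult [OF hom_Q f(1,3)] polynomial_hom_simps [OF \<theta>(1) f(1,3)]
          by (simp add: H mult_mem)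
      qed
      show "H (b \<oplus>\<^bsub>A\<^esub> b') = H b \<oplus>\<^bsub>quotient_algebra ?P I\<^esub> H b'"
        if b: "b \<in> carrier A" and b': "b' \<in> carrier A" for b b'
      proof -
        obtain f f' where f: "f \<in> carrier ?P" "b = \<theta> f" "f' \<in> carrier ?P" "b' = \<theta> f'"
          using surj [OF b] surj [OF b'] by blast
        then show ?thesis
          using H [of "f + f'"] ring_hom_add [OF hom_Q f(1,3)] polynomial_hom_simps [OF \<theta>(1) f(1,3)]
          by (simp add: H add_mem)
      qed
      show "H \<one>\<^bsub>A\<^esub> = \<one>\<^bsub>quotient_algebra ?P I\<^esub>"
        using H [of 1] polynomial_hom_simps(4) [OF \<theta>(1), of 1 1] ring_hom_one [OF hom_Q] by simp
      have "inj_on H (carrier A)"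
      proof (rule inj_onI)
        fix b b' assume *: "b \<in> carrier A" "b' \<in> carrier A" "H b = H b'"
        then obtain f where "f \<in> H b" using surj [of b] by (auto simp: H_def)
        with * show "b = b'" by (auto simp: H_def)
      qed
      moreover have "H ` carrier A = carrier (?P Quot I)"
      proof -
        have "H ` carrier A = (+>\<^bsub>?P\<^esub>) I ` carrier ?P"
          unfolding \<theta>(3) [symmetric] image_image by (rule image_cong [OF refl H])
        also have "\<dots> = carrier (?P Quot I)"
          by (auto simp: FactRing_def A_RCOSETS_def RCOSETS_def a_r_coset_def)
        finally show ?thesis .
      qed
      ultimately show "bij_betw H (carrier A) (carrier (quotient_algebra ?P I))"
        by (simp add: bij_betw_def)
    qed
    moreover have "H (c \<odot>\<^bsub>A\<^esub> b) = c \<odot>\<^bsub>quotient_algebra ?P I\<^esub> H b" if b: "b \<in> carrier A" for c b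
    proof -
      obtain f where f: "f \<in> carrier ?P" "b = \<theta> f" using surj [OF b] by blast
      have "H (c \<odot>\<^bsub>A\<^esub> b) = H (\<theta> (const_pol c * f))"
        using f \<theta>(2) by simp
      also have "\<dots> = I +>\<^bsub>?P\<^esub> (const_pol c * f)"
        using f by (intro H) (simp add: mult_mem)
      also have "\<dots> = c \<odot>\<^bsub>quotient_algebra ?P I\<^esub> H b"
        unfolding f(2) H [OF f(1)] by (rule smult_rcoset [OF I f(1), symmetric])
      finally show ?thesis .
    qed
    moreover have "H ` gr i = quotient_grading ?P I (homogeneous_component n) i" for i
      unfolding quotient_grading_def \<theta>(4) [symmetric] image_image
      by (rule image_cong [OF refl H]) (rule homogeneous_componentD)
    ultimately have "H \<in> ?iso"
      by (simp add: graded_algebra_iso_def)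
    then show "?iso \<noteq> {}" by blast
  qed
qed

lemma macaulay_dual_generator_iff:
  assumes "graded_algebra A gr"
  shows "macaulay_dual_generator A gr d n F \<longleftrightarrow> F \<in> homogeneous_component n d \<and>
    (\<exists>\<theta>. graded_presentation n \<theta> A gr \<and>
      (\<forall>f\<in>carrier (polynomial_algebra n). \<theta> f = \<zero>\<^bsub>A\<^esub> \<longleftrightarrow> diff_action f F = 0))"
  unfolding macaulay_dual_generator_def graded_algebra_iso_quotient_iff [OF ideal_Ann assms]
  by (auto simp: Ann_def set_eq_iff)


section \<open>Artinian Gorenstein algebras\<close>

lemma dim_1_proportional:
  assumes "vectorspace class_ring V" "vectorspace.fin_dim class_ring V"
    and "vectorspace.dim class_ring V = 1"
    and s: "s \<in> carrier V" and t: "t \<in> carrier V" "t \<noteq> \<zero>\<^bsub>V\<^esub>"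
  obtains c :: "'k::field" where "s = c \<odot>\<^bsub>V\<^esub> t"
proof -
  interpret V: vectorspace "class_ring :: 'k ring" V by fact
  have "\<exists>n A. finite A \<and> card A = n \<and> A \<subseteq> carrier V \<and> V.span A = carrier V"
    using assms(2) by (auto simp: V.fin_dim_def)
  then have "\<exists>A. finite A \<and> card A = V.dim \<and> A \<subseteq> carrier V \<and> V.span A = carrier V"
    unfolding V.dim_def by (rule LeastI_ex)
  then obtain v where v: "v \<in> carrier V" "V.span {v} = carrier V"
    using assms(3) by (auto simp: card_1_singleton_iff)
  have "\<exists>c. x = c \<odot>\<^bsub>V\<^esub> v" if x: "x \<in> carrier V" for x
  proof -
    from x v(2) obtain a where "x = V.lincomb a {v}"
      using V.finite_span [of "{v}"] v(1) by auto
    then have "x = a v \<odot>\<^bsub>V\<^esub> v" using v(1) by (simp add: V.lincomb_def)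
    then show ?thesis by blast
  qed
  with s t obtain a b where ab: "s = a \<odot>\<^bsub>V\<^esub> v" "t = b \<odot>\<^bsub>V\<^esub> v" by metis
  have "b \<noteq> 0"
  proof
    assume "b = 0"
    then have "t = \<zero>\<^bsub>V\<^esub>" using ab V.lmult_0 [OF v(1)] by simp
    with t show False by simp
  qed
  then have "s = (a / b) \<odot>\<^bsub>V\<^esub> t"
    using V.smult_assoc1 [of "a / b" b v] ab v(1) by simp
  then show thesis by (rule that)
qed

text \<open>
Among the homogeneous \<open>x\<close> with \<open>b x \<noteq> 0\<close> take one of maximal degree: then \<open>b x\<close> is annihilated by
everything of positive degree, so it lies in the socle. The socle is a line and contains the
nonzero space \<open>C\<^sub>d\<close>, hence equals it.
\<close>

lemma gorenstein_multiple_in_top_degree: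
  assumes C: "graded_algebra C gr" and gor: "artinian_gorenstein C gr"
    and d: "has_socle_degree C gr d"
    and b: "b \<in> carrier C" "b \<noteq> \<zero>\<^bsub>C\<^esub>"
  obtains x where "x \<in> carrier C" "b \<otimes>\<^bsub>C\<^esub> x \<in> gr d" "b \<otimes>\<^bsub>C\<^esub> x \<noteq> \<zero>\<^bsub>C\<^esub>"
proof -
  interpret C: graded_algebra C gr by (rule C)
  have gr_carrier: "x \<in> carrier C" if "x \<in> gr i" for x i
    using C.gr_submodule [of i] that by (auto simp: LinearCombinations.submodule_def)
  have zero_degree: "x = \<zero>\<^bsub>C\<^esub>" if "x \<in> gr i" "i > d" for x i
    using d that by (auto simp: has_socle_degree_def)
  define D where "D = {j. \<exists>x\<in>gr j. b \<otimes>\<^bsub>C\<^esub> x \<noteq> \<zero>\<^bsub>C\<^esub>}"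
  have "D \<subseteq> {..d}"
    using zero_degree b(1) by (force simp: D_def)
  then have "finite D" by (rule finite_subset) simp
  moreover have "0 \<in> D"
    using C.gr_one b by (auto simp: D_def intro!: bexI [of _ "\<one>\<^bsub>C\<^esub>"])
  ultimately have j: "Max D \<in> D" and max: "\<And>i. i \<in> D \<Longrightarrow> i \<le> Max D"
    by (auto intro: Max_in)
  from j obtain x where x: "x \<in> gr (Max D)" and bx: "b \<otimes>\<^bsub>C\<^esub> x \<noteq> \<zero>\<^bsub>C\<^esub>"
    by (auto simp: D_def)
  let ?s = "b \<otimes>\<^bsub>C\<^esub> x"
  have "?s \<otimes>\<^bsub>C\<^esub> y = \<zero>\<^bsub>C\<^esub>" if y: "y \<in> gr i" "i > 0" for y i
  proof (rule ccontr)
    assume "?s \<otimes>\<^bsub>C\<^esub> y \<noteq> \<zero>\<^bsub>C\<^esub>"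
    then have "b \<otimes>\<^bsub>C\<^esub> (x \<otimes>\<^bsub>C\<^esub> y) \<noteq> \<zero>\<^bsub>C\<^esub>"
      using b(1) gr_carrier [OF x] gr_carrier [OF y(1)] by (simp add: C.m_assoc)
    then have "Max D + i \<in> D"
      using C.gr_mult [OF x y(1)] by (auto simp: D_def)
    with max y(2) show False by fastforce
  qed
  then have s: "?s \<in> graded_socle C gr"
    using b(1) gr_carrier [OF x] by (auto simp: graded_socle_def)
  have "\<zero>\<^bsub>C\<^esub> \<in> gr d"
    using C.gr_submodule [of d] by (simp add: LinearCombinations.submodule_def)
  then obtain t where t: "t \<in> gr d" "t \<noteq> \<zero>\<^bsub>C\<^esub>"
    using d by (auto simp: has_socle_degree_def)
  have t_socle: "t \<in> graded_socle C gr"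
    using gr_carrier [OF t(1)] zero_degree [OF C.gr_mult [OF t(1)]] by (auto simp: graded_socle_def)
  have "LinearCombinations.submodule class_ring (graded_socle C gr) C"
    using gr_carrier
    by (auto simp: LinearCombinations.submodule_def graded_socle_def C.module_axioms C.l_distr
          C.smult_assoc2)
  then have "vectorspace class_ring (C\<lparr>carrier := graded_socle C gr\<rparr>)"
    using C.submodule_is_module class_field by (auto simp: vectorspace_def)
  then obtain c where "?s = c \<odot>\<^bsub>C\<lparr>carrier := graded_socle C gr\<rparr>\<^esub> t"
    by (rule dim_1_proportional [where s = ?s and t = t])
       (use gor s t t_socle in \<open>auto simp: artinian_gorenstein_def\<close>)
  then have "?s \<in> gr d"
    using C.gr_submodule [of d] t(1) by (simp add: LinearCombinations.submodule_def)
  with that [OF gr_carrier [OF x]] bx show thesis by blast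
qed

section \<open>Matrices of full rank\<close>

text \<open>
A reduced echelon basis without an elimination procedure: among the sets \<open>J\<close> of coordinates that
carry unit vectors of \<open>W\<close> take a largest one. If subtracting from \<open>v \<in> W\<close> the combination that agrees
with it on \<open>J\<close> left a nonzero entry at \<open>i\<close>, the remainder could be used to adjoin \<open>i\<close> to \<open>J\<close>.
\<close>

lemma reduced_basis:
  fixes W :: "(nat \<Rightarrow> 'k::field) set"
  assumes add: "\<And>v w. v \<in> W \<Longrightarrow> w \<in> W \<Longrightarrow> (\<lambda>i. v i + w i) \<in> W"
    and scale: "\<And>c w. w \<in> W \<Longrightarrow> (\<lambda>i. c * w i) \<in> W"
  obtains J w where "J \<subseteq> {..<n}" "\<forall>j\<in>J. w j \<in> W"
    "\<forall>j\<in>J. \<forall>k\<in>J. w j k = (if j = k then 1 else 0)"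
    "\<forall>v\<in>W. \<forall>i<n. v i = (\<Sum>j\<in>J. v j * w j i)"
proof -
  define good where "good J w \<longleftrightarrow> J \<subseteq> {..<n} \<and> (\<forall>j\<in>J. w j \<in> W \<and>
      (\<forall>k\<in>J. w j k = (if j = k then 1 else 0)))" for J and w :: "nat \<Rightarrow> nat \<Rightarrow> 'k"
  have "\<exists>w. good {} w" by (simp add: good_def)
  moreover have "\<forall>J. (\<exists>w. good J w) \<longrightarrow> card J < Suc n"
  proof (intro allI impI, elim exE)
    fix J w assume "good J w"
    then have "J \<subseteq> {..<n}" by (simp add: good_def)
    then show "card J < Suc n" using card_mono [of "{..<n}" J] by simp
  qed
  ultimately obtain J where "\<exists>w. good J w" and max: "\<And>J'. (\<exists>w. good J' w) \<Longrightarrow> card J' \<le> card J"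
    using ex_has_greatest_nat [of "\<lambda>J. \<exists>w. good J w" "{}" card "Suc n"] by blast
  from this(1) obtain w where w: "good J w" by blast
  have fin: "finite J" using w finite_subset by (auto simp: good_def)
  have J: "J \<subseteq> {..<n}" and wW: "\<And>j. j \<in> J \<Longrightarrow> w j \<in> W"
    and \<delta>: "\<And>j k. j \<in> J \<Longrightarrow> k \<in> J \<Longrightarrow> w j k = (if j = k then 1 else 0)"
    using w by (auto simp: good_def)
  have rep: "v i = (\<Sum>j\<in>J. v j * w j i)" if v: "v \<in> W" and i: "i < n" for v i
  proof (rule ccontr)
    assume neq: "v i \<noteq> (\<Sum>j\<in>J. v j * w j i)"
    define r where "r k = v k - (\<Sum>j\<in>J. v j * w j k)" for k
    have "(\<lambda>k. v k + (\<Sum>j\<in>S. - v j * w j k)) \<in> W" if "finite S" "S \<subseteq> J" for S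
      using that
    proof (induction S rule: finite_induct)
      case (insert j S)
      then show ?case
        using add [OF insert(3) scale [OF wW, of j "- v j"]] by (simp add: algebra_simps)
    qed (simp add: v)
    from this [OF fin order_refl] have rW: "r \<in> W"
      by (simp add: r_def [abs_def] sum_negf)
    have r0: "r k = 0" if "k \<in> J" for k
    proof -
      have "(\<Sum>j\<in>J. v j * w j k) = (\<Sum>j\<in>J. if j = k then v j else 0)"
        by (rule sum.cong) (simp_all add: \<delta> that)
      then show ?thesis using fin that by (simp add: r_def)
    qed
    have ri: "r i \<noteq> 0" using neq by (simp add: r_def)
    with r0 have iJ: "i \<notin> J" by blast
    define q where "q k = inverse (r i) * r k" for k
    have q: "q \<in> W" "q i = 1" "\<And>k. k \<in> J \<Longrightarrow> q k = 0"
      using scale [OF rW, of "inverse (r i)"] ri r0 by (simp_all add: q_def [abs_def])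
    \<comment> \<open>Clear the entry at the new pivot \<open>i\<close> from the vectors already chosen.\<close>
    define w' where "w' j = (if j = i then q else (\<lambda>k. w j k + - w j i * q k))" for j
    have "w' j \<in> W" if "j \<in> insert i J" for j
      using that q(1) add [OF wW scale [OF q(1)], of j "- w j i"] by (auto simp: w'_def)
    moreover have "w' j k = (if j = k then 1 else 0)" if "j \<in> insert i J" "k \<in> insert i J" for j k
      using that q iJ \<delta> by (auto simp: w'_def)
    ultimately have "good (insert i J) w'"
      using J i by (auto simp: good_def)
    then have "card (insert i J) \<le> card J" using max by blast
    with fin iJ show False by simp
  qed
  show thesis
    by (rule that [of J w]) (intro ballI allI impI J wW \<delta> rep; assumption)+
qed

text \<open>
The columns \<open>e 0, \<dots>, e (m - 1)\<close> of \<open>M\<close> are the unit vectors, so the columns span the whole space.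
\<close>

lemma rank_eq_dim_row:
  fixes M :: "'k::field mat"
  assumes M: "M \<in> carrier_mat m n"
    and e: "\<And>k. k < m \<Longrightarrow> e k < n"
    and \<delta>: "\<And>i k. i < m \<Longrightarrow> k < m \<Longrightarrow> M $$ (i, e k) = (if i = k then 1 else 0)"
  shows "vec_space.rank m M = m"
proof -
  interpret vec_space "TYPE('k)" m .
  have col: "col M (e k) = unit_vec m k" if "k < m" for k
    using that M e [OF that] \<delta> by (intro eq_vecI) (auto simp: unit_vec_def)
  have units: "set (unit_vecs m) \<subseteq> set (cols M)"
  proof
    fix v :: "'k vec"
    assume "v \<in> set (unit_vecs m)"
    then obtain k where k: "k < m" "v = unit_vec m k" by (auto simp: unit_vecs_def)
    have "col M (e k) \<in> set (cols M)"
      using M e [OF k(1)] by (simp add: cols_def)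
    then show "v \<in> set (cols M)" by (simp add: col k)
  qed
  have cols: "set (cols M) \<subseteq> carrier_vec m"
    using M cols_dim by blast
  have "carrier_vec m \<subseteq> span (set (cols M))"
    using span_is_monotone [OF units] by (simp add: span_unit_vecs_is_carrier)
  moreover have "span (set (cols M)) \<subseteq> carrier_vec m"
    using span_is_subset2 [of "set (cols M)"] cols by simp
  ultimately have "span (set (cols M)) = carrier_vec m" by (rule subset_antisym [rotated])
  moreover have "(module_vec TYPE('k) m)\<lparr>carrier := carrier_vec m\<rparr> = module_vec TYPE('k) m"
    by (simp add: module_vec_def)
  ultimately show ?thesis
    unfolding rank_def using dim_is_n by metis
qed

section \<open>The dual generator of a subalgebra\<close>

text \<open>
A surjection that sends the variables to degree \<open>1\<close> respects degrees, and it maps each graded piece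
onto the corresponding one: if \<open>b\<close> of degree \<open>e\<close> is the image of \<open>f\<close>, the images of the homogeneous
parts of \<open>f\<close> form a decomposition of \<open>b\<close>, which is unique, so \<open>b\<close> is the image of the part of degree \<open>e\<close>.
\<close>

lemma graded_presentationI:
  assumes C: "graded_algebra C gr"
    and hom: "\<theta> \<in> Ring.ring_hom (polynomial_algebra m) C"
    and smult: "\<And>c f. f \<in> carrier (polynomial_algebra m) \<Longrightarrow>
      \<theta> (const_pol c * f) = c \<odot>\<^bsub>C\<^esub> \<theta> f"
    and surj: "\<theta> ` carrier (polynomial_algebra m) = carrier C"
    and var: "\<And>i. i < m \<Longrightarrow> \<theta> (var_pol i) \<in> gr 1"
  shows "graded_presentation m \<theta> C gr"
proof -
  interpret C: graded_algebra C gr by (rule C)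
  note sub = C.gr_submodule [unfolded LinearCombinations.submodule_def]
  note hom_simps = polynomial_hom_simps [OF hom]
  have one: "\<theta> 1 = \<one>\<^bsub>C\<^esub>" by (rule hom_simps(4) [OF zero_mem zero_mem])
  have zero: "\<theta> 0 = \<zero>\<^bsub>C\<^esub>"
    using smult [of 1 0] C.lmult_0 [of "\<one>\<^bsub>C\<^esub>"] by (simp add: one)
  have degree: "\<theta> f \<in> gr e" if "f \<in> homogeneous_component m e" for f e
  proof -
    from that have "f \<in> carrier (polynomial_algebra m) \<and> \<theta> f \<in> gr e"
    proof (induction f rule: homogeneous_component_induct)
      case (const c)
      have "\<theta> (const_pol c) = c \<odot>\<^bsub>C\<^esub> \<one>\<^bsub>C\<^esub>"
        using smult [of 1 c] by (simp add: one)
      then show ?case using sub [of 0] C.gr_one by simp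
    next
      case (zero e)
      then show ?case using sub [of e] \<open>\<theta> 0 = \<zero>\<^bsub>C\<^esub>\<close> by simp
    next
      case (add e p q)
      then show ?case using sub [of e] by (simp add: hom_simps add_mem)
    next
      case (var_mult e i p)
      then have "\<theta> (var_pol i) \<otimes>\<^bsub>C\<^esub> \<theta> p \<in> gr (1 + e)"
        by (intro C.gr_mult var) auto
      with var_mult show ?case by (simp add: hom_simps mult_mem var_mem)
    qed
    then show ?thesis by blast
  qed
  have support: "finsum C c {i. c i \<noteq> \<zero>\<^bsub>C\<^esub>} = finsum C c S"
    if "finite S" "{i. c i \<noteq> \<zero>\<^bsub>C\<^esub>} \<subseteq> S" "\<And>i. c i \<in> carrier C" for c and S :: "nat set"
    using that by (intro C.add.finprod_mono_neutral_cong_left) auto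
  have "gr e \<subseteq> \<theta> ` homogeneous_component m e" for e
  proof
    fix b assume b: "b \<in> gr e"
    then have bC: "b \<in> carrier C" using sub [of e] by blast
    then obtain f where f: "f \<in> carrier (polynomial_algebra m)" "b = \<theta> f"
      unfolding surj [symmetric] by (rule imageE) blast
    obtain N q where q: "\<And>j. q j \<in> homogeneous_component m j" and fq: "f = (\<Sum>j<N. q j)"
      using homogeneous_decomposition [OF f(1)] by blast
    have q_mem: "q j \<in> carrier (polynomial_algebra m)" for j
      by (rule homogeneous_componentD [OF q])
    have sum: "\<theta> (\<Sum>j<k. q j) = (\<Oplus>\<^bsub>C\<^esub>j\<in>{..<k}. \<theta> (q j))" for k
    proof (induction k)
      case (Suc k)
      have "\<theta> (\<Sum>j<Suc k. q j) = \<theta> (q k) \<oplus>\<^bsub>C\<^esub> \<theta> (\<Sum>j<k. q j)"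
        by (simp add: hom_simps q_mem sum_mem add.commute)
      also have "\<dots> = (\<Oplus>\<^bsub>C\<^esub>j\<in>{..<Suc k}. \<theta> (q j))"
        unfolding lessThan_Suc Suc
        by (subst C.finsum_insert) (auto intro: hom_simps(1) q_mem)
      finally show ?case .
    qed (simp add: zero)
    \<comment> \<open>Two decompositions of \<open>b\<close> into homogeneous parts: the trivial one and the image of that of \<open>f\<close>.\<close>
    define c where "c j = (if j = e then b else \<zero>\<^bsub>C\<^esub>)" for j
    define c' where "c' j = (if j < N then \<theta> (q j) else \<zero>\<^bsub>C\<^esub>)" for j
    have "(\<forall>i. c i \<in> gr i) \<and> finite {i. c i \<noteq> \<zero>\<^bsub>C\<^esub>}
        \<and> b = (\<Oplus>\<^bsub>C\<^esub>i\<in>{i. c i \<noteq> \<zero>\<^bsub>C\<^esub>}. c i)"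
    proof (intro conjI allI)
      show "c i \<in> gr i" for i using b sub [of i] by (simp add: c_def)
      have "{i. c i \<noteq> \<zero>\<^bsub>C\<^esub>} \<subseteq> {e}" by (auto simp: c_def)
      then show "finite {i. c i \<noteq> \<zero>\<^bsub>C\<^esub>}" by (rule finite_subset) simp
      have "finsum C c {i. c i \<noteq> \<zero>\<^bsub>C\<^esub>} = finsum C c {e}"
        by (rule support) (auto simp: c_def bC)
      also have "\<dots> = b"
        using C.finsum_insert [of "{}" e c] bC by (simp add: c_def)
      finally show "b = finsum C c {i. c i \<noteq> \<zero>\<^bsub>C\<^esub>}" ..
    qed
    moreover have "(\<forall>i. c' i \<in> gr i) \<and> finite {i. c' i \<noteq> \<zero>\<^bsub>C\<^esub>}
        \<and> b = (\<Oplus>\<^bsub>C\<^esub>i\<in>{i. c' i \<noteq> \<zero>\<^bsub>C\<^esub>}. c' i)"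
    proof (intro conjI allI)
      show c'_gr: "c' i \<in> gr i" for i using degree [OF q] sub [of i] by (simp add: c'_def)
      have "{i. c' i \<noteq> \<zero>\<^bsub>C\<^esub>} \<subseteq> {..<N}" by (auto simp: c'_def)
      then show "finite {i. c' i \<noteq> \<zero>\<^bsub>C\<^esub>}" by (rule finite_subset) simp
      have "finsum C c' {i. c' i \<noteq> \<zero>\<^bsub>C\<^esub>} = finsum C c' {..<N}"
        by (rule support) (auto simp: c'_def hom_simps(1) [OF q_mem zero_mem])
      also have "\<dots> = (\<Oplus>\<^bsub>C\<^esub>j\<in>{..<N}. \<theta> (q j))"
        by (rule C.finsum_cong') (auto simp: c'_def hom_simps(1) [OF q_mem zero_mem])
      finally show "b = finsum C c' {i. c' i \<noteq> \<zero>\<^bsub>C\<^esub>}"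
        unfolding f(2) fq sum ..
    qed
    ultimately have "c = c'"
      using C.gr_decomposition [OF bC] by blast
    then have "b = c' e" using c_def by metis
    then show "b \<in> \<theta> ` homogeneous_component m e"
      using q [of e] zero by (auto simp: c'_def intro: image_eqI [of _ _ 0])
  qed
  with degree have "\<theta> ` homogeneous_component m e = gr e" for e by blast
  with hom smult surj show ?thesis
    by (simp add: graded_presentation_def)
qed

text \<open>
The heart of the argument. The hypothesis on \<open>\<theta>\<close> says that its kernel is \<open>\<psi>\<^sup>-\<^sup>1(Ann F)\<close>, where \<open>\<psi>\<close>
substitutes the rows of \<open>M\<close>; the conclusion is that this is the annihilator of the polynomial
obtained from \<open>F\<close> by substituting the columns.
\<close>

theorem annihilator_of_substitution:
  assumes C: "graded_algebra C gr" and gor: "artinian_gorenstein C gr"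
    and d: "has_socle_degree C gr d"
    and pres: "graded_presentation m \<theta> C gr"
    and F: "F \<in> homogeneous_component n d"
    and ker: "\<And>f. f \<in> carrier (polynomial_algebra m) \<Longrightarrow>
      \<theta> f = \<zero>\<^bsub>C\<^esub> \<longleftrightarrow> diff_action (substitute (\<lambda>i. linear_form n (M i)) f) F = 0"
    and f: "f \<in> carrier (polynomial_algebra m)"
  shows "\<theta> f = \<zero>\<^bsub>C\<^esub> \<longleftrightarrow>
    diff_action f (substitute (\<lambda>j. linear_form m (\<lambda>i. M i j)) F) = 0"
proof -
  interpret C: graded_algebra C gr by (rule C)
  note \<theta> = graded_presentationD [OF pres]
  define \<psi> where "\<psi> = substitute (\<lambda>i. linear_form n (M i))"
  define \<sigma> where "\<sigma> = substitute (\<lambda>j. linear_form m (\<lambda>i. M i j))"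
  have chain: "diff_action g (\<sigma> F) = \<sigma> (diff_action (\<psi> g) F)"
    if "g \<in> carrier (polynomial_algebra m)" for g
    unfolding \<sigma>_def \<psi>_def
    by (rule diff_action_linear_substitution [OF that homogeneous_componentD [OF F]])
  \<comment> \<open>The kernel annihilates \<open>\<sigma> F\<close>: apply \<open>\<sigma>\<close> to \<open>\<psi> g \<circ> F = 0\<close>.\<close>
  have forward: "diff_action g (\<sigma> F) = 0" if "g \<in> carrier (polynomial_algebra m)" "\<theta> g = \<zero>\<^bsub>C\<^esub>" for g
    using chain [OF that(1)] ker [OF that(1)] that(2) by (simp add: \<psi>_def \<sigma>_def)
  have "diff_action f (\<sigma> F) \<noteq> 0" if "\<theta> f \<noteq> \<zero>\<^bsub>C\<^esub>"
  proof
    assume zero: "diff_action f (\<sigma> F) = 0"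
    have "\<theta> f \<in> carrier C" by (rule ring_hom_closed [OF \<theta>(1) f])
    then obtain x where x: "x \<in> carrier C" "\<theta> f \<otimes>\<^bsub>C\<^esub> x \<in> gr d" "\<theta> f \<otimes>\<^bsub>C\<^esub> x \<noteq> \<zero>\<^bsub>C\<^esub>"
      using gorenstein_multiple_in_top_degree [OF C gor d _ \<open>\<theta> f \<noteq> \<zero>\<^bsub>C\<^esub>\<close>] by blast
    obtain g where g: "g \<in> carrier (polynomial_algebra m)" "x = \<theta> g"
      using x(1) unfolding \<theta>(3) [symmetric] by (rule imageE) blast
    obtain h where h: "h \<in> homogeneous_component m d" "\<theta> f \<otimes>\<^bsub>C\<^esub> x = \<theta> h"
      using x(2) unfolding \<theta>(4) [symmetric] by (rule imageE) blast
    have h_mem: "h \<in> carrier (polynomial_algebra m)"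
      by (rule homogeneous_componentD [OF h(1)])
    \<comment> \<open>The polynomials \<open>g f\<close> and \<open>h\<close> have the same image, so they act alike on \<open>\<sigma> F\<close>; the first kills it.\<close>
    have gf: "g * f \<in> carrier (polynomial_algebra m)" and neg: "const_pol (- 1) * h \<in> carrier (polynomial_algebra m)"
      using f g h_mem by (simp_all add: mult_mem)
    have "\<theta> (g * f) = \<theta> h"
      using polynomial_hom_simps(3) [OF \<theta>(1) g(1) f] h(2) g(2) C.m_comm
        ring_hom_closed [OF \<theta>(1) f] ring_hom_closed [OF \<theta>(1) g(1)] by simp
    then have "\<theta> (g * f + const_pol (- 1) * h) = \<theta> h \<oplus>\<^bsub>C\<^esub> (- 1) \<odot>\<^bsub>C\<^esub> \<theta> h"
      using polynomial_hom_simps(2) [OF \<theta>(1) gf neg] \<theta>(2) [OF h_mem] by simp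
    also have "\<dots> = (1 + - 1) \<odot>\<^bsub>C\<^esub> \<theta> h"
      using C.smult_l_distr [of 1 "- 1" "\<theta> h"] C.smult_one [of "\<theta> h"]
        ring_hom_closed [OF \<theta>(1) h_mem] by simp
    also have "\<dots> = \<zero>\<^bsub>C\<^esub>"
      using C.lmult_0 [OF ring_hom_closed [OF \<theta>(1) h_mem]] by simp
    finally have "diff_action (g * f + const_pol (- 1) * h) (\<sigma> F) = 0"
      by (intro forward add_mem gf neg)
    then have "diff_action h (\<sigma> F) = 0"
      using zero unfolding diff_action_add diff_action_mult [of g] diff_action_const_mult
      by (simp add: const_pol_uminus)
    \<comment> \<open>In degree \<open>d\<close> nothing is lost under \<open>\<sigma>\<close>, because \<open>\<psi> h \<circ> F\<close> is a constant.\<close>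
    moreover have "diff_action (\<psi> h) F \<in> homogeneous_component n (d - d)"
      unfolding \<psi>_def
      by (rule diff_action_homogeneous [OF substitute_homogeneous [OF h(1)] F])
         (rule linear_form_homogeneous)
    then obtain c where c: "diff_action (\<psi> h) F = const_pol c"
      by (auto elim: homogeneous_component_0)
    ultimately have "diff_action (\<psi> h) F = 0"
      using chain [OF h_mem] by (simp add: \<sigma>_def)
    then have "\<theta> h = \<zero>\<^bsub>C\<^esub>"
      using ker [OF h_mem] by (simp add: \<psi>_def)
    with x(3) h(2) show False by simp
  qed
  with forward [OF f] show ?thesis
    unfolding \<sigma>_def by blast
qed

text \<open>
Restricting the presentation of \<open>A\<close> to the linear forms with image in \<open>B\<^sub>1\<close> presents \<open>B\<close>: the image of
the restricted map is a subalgebra contained in \<open>B\<close> that contains the generators \<open>B\<^sub>1\<close>.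
\<close>

theorem subalgebra_presentation:
  assumes A: "graded_algebra A A_gr" and pres: "graded_presentation n \<theta> A A_gr"
    and B: "graded_subalgebra A A_gr B B_gr" and gen: "B = generated_subalgebra A (B_gr 1)"
  obtains m M where "m \<le> n" "vec_space.rank m (mat m n (\<lambda>(i, j). M i j)) = m"
    "graded_presentation m (\<lambda>f. \<theta> (substitute (\<lambda>i. linear_form n (M i)) f)) (A\<lparr>carrier := B\<rparr>) B_gr"
proof -
  interpret A: graded_algebra A A_gr by (rule A)
  have B': "graded_algebra (A\<lparr>carrier := B\<rparr>) B_gr" and B_sub: "is_subalgebra B A"
    and B_gr: "\<And>i. B_gr i \<subseteq> A_gr i"
    using B by (auto simp: graded_subalgebra_def)
  interpret B: graded_algebra "A\<lparr>carrier := B\<rparr>" B_gr by (rule B')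
  note \<theta> = graded_presentationD [OF pres]
  note \<theta>_simps = polynomial_hom_simps [OF \<theta>(1)]
  have B1: "x \<oplus>\<^bsub>A\<^esub> y \<in> B_gr 1" "c \<odot>\<^bsub>A\<^esub> x \<in> B_gr 1" "x \<in> B"
    if "x \<in> B_gr 1" "y \<in> B_gr 1" for x y c
    using B.gr_submodule [of 1] that by (auto simp: LinearCombinations.submodule_def)
  define W where "W = {a. \<theta> (linear_form n a) \<in> B_gr 1}"
  have W_add: "(\<lambda>i. v i + w i) \<in> W" if "v \<in> W" "w \<in> W" for v w
    using that B1(1) by (simp add: W_def linear_form_add \<theta>_simps linear_form_mem)
  have W_scale: "(\<lambda>i. c * w i) \<in> W" if "w \<in> W" for c w
    using that B1(2) by (simp add: W_def linear_form_scale \<theta>(2) linear_form_mem)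
  obtain J w where J: "J \<subseteq> {..<n}" and w: "\<forall>j\<in>J. w j \<in> W"
    and \<delta>: "\<forall>j\<in>J. \<forall>k\<in>J. w j k = (if j = k then 1 else 0)"
    and rep: "\<forall>v\<in>W. \<forall>i<n. v i = (\<Sum>j\<in>J. v j * w j i)"
    by (rule reduced_basis [of W n, OF W_add W_scale])
  define m where "m = card J"
  have "finite J" using J by (rule finite_subset) simp
  then obtain e where e: "bij_betw e {..<m} J"
    using ex_bij_betw_nat_finite [of J] by (auto simp: m_def atLeast0LessThan)
  have eJ: "e i \<in> J" if "i < m" for i
    using e that by (auto simp: bij_betw_def)
  have e_inj: "e i = e k \<longleftrightarrow> i = k" if "i < m" "k < m" for i k
    using e that by (auto simp: bij_betw_def inj_on_def)
  define M where "M i = w (e i)" for i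
  define \<psi> where "\<psi> = substitute (\<lambda>i. linear_form n (M i))"
  have \<psi>_mem: "\<psi> f \<in> carrier (polynomial_algebra n)" if "f \<in> carrier (polynomial_algebra m)" for f
    unfolding \<psi>_def by (rule substitute_mem [OF that linear_form_mem])
  have \<psi>_simps: "\<psi> (f + g) = \<psi> f + \<psi> g" "\<psi> (f * g) = \<psi> f * \<psi> g" "\<psi> (const_pol c * f) = const_pol c * \<psi> f"
    "\<psi> 1 = 1" "\<psi> 0 = 0" "\<psi> (const_pol c) = const_pol c" for f g c
    by (simp_all add: \<psi>_def substitute_add substitute_mult substitute_const_mult)
  have \<psi>_var: "\<psi> (var_pol i) = linear_form n (M i)" for i
    using substitute_var_mult [of _ i 1] by (simp add: \<psi>_def)
  have one: "\<theta> 1 = \<one>\<^bsub>A\<^esub>" by (rule \<theta>_simps(4) [OF zero_mem zero_mem])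
  have zero: "\<theta> 0 = \<zero>\<^bsub>A\<^esub>"
    using \<theta>(2) [of 1 0] A.lmult_0 [of "\<one>\<^bsub>A\<^esub>"] by (simp add: one)
  have const: "\<theta> (const_pol c) = c \<odot>\<^bsub>A\<^esub> \<one>\<^bsub>A\<^esub>" for c
    using \<theta>(2) [of 1 c] by (simp add: one)
  have var: "\<theta> (\<psi> (var_pol i)) \<in> B_gr 1" if "i < m" for i
    using bspec [OF w eJ [OF that]] by (simp add: W_def \<psi>_var M_def)
  have into: "\<theta> (\<psi> f) \<in> B" if "f \<in> carrier (polynomial_algebra m)" for f
  proof -
    from that have "f \<in> carrier (polynomial_algebra m) \<and> \<theta> (\<psi> f) \<in> B"
    proof (induction f rule: polynomial_algebra_induct)
      case (const c)
      have "c \<odot>\<^bsub>A\<^esub> \<one>\<^bsub>A\<^esub> \<in> B"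
        using B.smult_closed [of c "\<one>\<^bsub>A\<^esub>"] B.one_closed by simp
      then show ?case by (simp add: \<psi>_simps \<open>\<theta> (const_pol c) = _\<close>)
    next
      case (add p q)
      then show ?case
        using B.a_closed [of "\<theta> (\<psi> p)" "\<theta> (\<psi> q)"]
        by (simp add: \<psi>_simps \<theta>_simps \<psi>_mem add_mem)
    next
      case (var_mult i p)
      then show ?case
        using B.m_closed [of "\<theta> (\<psi> (var_pol i))" "\<theta> (\<psi> p)"] B1(3) [OF var var, of i i]
        by (simp add: \<psi>_simps \<theta>_simps \<psi>_mem mult_mem var_mem)
    qed
    then show ?thesis by blast
  qed
  let ?C = "(\<lambda>f. \<theta> (\<psi> f)) ` carrier (polynomial_algebra m)"
  have "is_subalgebra ?C A"
    unfolding is_subalgebra_def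
  proof
    show "subring ?C A"
    proof (rule A.subringI)
      show "?C \<subseteq> carrier A" using \<theta>_simps(1) [OF \<psi>_mem zero_mem] by blast
      show "\<one>\<^bsub>A\<^esub> \<in> ?C" by (rule image_eqI [of _ _ 1]) (simp_all add: \<psi>_simps one)
    next
      fix h assume "h \<in> ?C"
      then obtain f where f: "f \<in> carrier (polynomial_algebra m)" "h = \<theta> (\<psi> f)" by blast
      have \<psi>_uminus: "\<psi> (- f) = - \<psi> f"
        using \<psi>_simps(1) [of f "- f"] by (simp add: \<psi>_simps(5) minus_unique)
      have "\<ominus>\<^bsub>A\<^esub> h = \<theta> (\<psi> (- f))"
        using \<theta>_simps(2) [OF \<psi>_mem [OF uminus_mem [OF f(1)]] \<psi>_mem [OF f(1)]]
          \<theta>_simps(1) [OF \<psi>_mem [OF f(1)] zero_mem]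
          \<theta>_simps(1) [OF \<psi>_mem [OF uminus_mem [OF f(1)]] zero_mem]
        by (intro A.minus_equality) (simp_all add: f(2) \<psi>_uminus zero)
      then show "\<ominus>\<^bsub>A\<^esub> h \<in> ?C" using uminus_mem [OF f(1)] by blast
    next
      fix h1 h2 assume "h1 \<in> ?C" "h2 \<in> ?C"
      then obtain f1 f2 where f: "f1 \<in> carrier (polynomial_algebra m)" "h1 = \<theta> (\<psi> f1)"
        "f2 \<in> carrier (polynomial_algebra m)" "h2 = \<theta> (\<psi> f2)" by blast
      have "h1 \<otimes>\<^bsub>A\<^esub> h2 = \<theta> (\<psi> (f1 * f2))" "h1 \<oplus>\<^bsub>A\<^esub> h2 = \<theta> (\<psi> (f1 + f2))"
        by (simp_all add: f \<psi>_simps \<theta>_simps \<psi>_mem)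
      then show "h1 \<otimes>\<^bsub>A\<^esub> h2 \<in> ?C" "h1 \<oplus>\<^bsub>A\<^esub> h2 \<in> ?C"
        using mult_mem [OF f(1,3)] add_mem [OF f(1,3)] by blast+
    qed
    then have C: "?C \<subseteq> carrier A" "\<And>x y. x \<in> ?C \<Longrightarrow> y \<in> ?C \<Longrightarrow> x \<oplus>\<^bsub>A\<^esub> y \<in> ?C"
      by (auto simp: subringE)
    have "\<zero>\<^bsub>A\<^esub> \<in> ?C" by (rule image_eqI [of _ _ 0]) (simp_all add: \<psi>_simps zero)
    moreover have "c \<odot>\<^bsub>A\<^esub> x \<in> ?C" if "x \<in> ?C" for c x
    proof -
      from that obtain f where f: "f \<in> carrier (polynomial_algebra m)" "x = \<theta> (\<psi> f)" by blast
      then have "c \<odot>\<^bsub>A\<^esub> x = \<theta> (\<psi> (const_pol c * f))"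
        by (simp add: \<psi>_simps \<theta>(2) \<psi>_mem)
      moreover have "const_pol c * f \<in> carrier (polynomial_algebra m)"
        using f(1) by (simp add: mult_mem)
      ultimately show ?thesis by blast
    qed
    ultimately show "LinearCombinations.submodule class_ring ?C A"
      using C A.module_axioms unfolding LinearCombinations.submodule_def by blast
  qed
  moreover have "B_gr 1 \<subseteq> ?C"
  proof
    fix b assume b: "b \<in> B_gr 1"
    then have "b \<in> \<theta> ` homogeneous_component n 1"
      using B_gr [of 1] \<theta>(4) [of 1] by blast
    then obtain p where p: "b = \<theta> p" "p \<in> homogeneous_component n 1" by (rule imageE)
    from p(2) obtain a where "p = linear_form n a" by (rule homogeneous_component_1)
    with p(1) have a: "b = \<theta> (linear_form n a)" by simp
    with b have "a \<in> W" by (simp add: W_def)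
    then have "linear_form n a = linear_form n (\<lambda>k. \<Sum>j\<in>J. a j * w j k)"
      by (intro linear_form_cong rep [rule_format])
    also have "\<dots> = (\<Sum>j\<in>J. const_pol (a j) * linear_form n (w j))"
      by (simp add: linear_form_sum linear_form_scale)
    also have "\<dots> = (\<Sum>i<m. const_pol (a (e i)) * linear_form n (M i))"
      unfolding M_def by (rule sum.reindex_bij_betw [OF e, symmetric])
    also have "\<dots> = \<psi> (linear_form m (\<lambda>i. a (e i)))"
      by (simp add: \<psi>_def substitute_linear_form)
    finally have "b = \<theta> (\<psi> (linear_form m (\<lambda>i. a (e i))))"
      using a by simp
    then show "b \<in> ?C"
      by (rule image_eqI) (rule linear_form_mem)
  qed
  ultimately have "B \<subseteq> ?C"
    unfolding gen generated_subalgebra_def by blast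
  with into have surj: "?C = B" by blast
  have "graded_presentation m (\<lambda>f. \<theta> (\<psi> f)) (A\<lparr>carrier := B\<rparr>) B_gr"
  proof (rule graded_presentationI [OF B'])
    show "(\<lambda>f. \<theta> (\<psi> f)) \<in> Ring.ring_hom (polynomial_algebra m) (A\<lparr>carrier := B\<rparr>)"
      by (rule ring_hom_memI) (simp_all add: into \<psi>_simps \<theta>_simps \<psi>_mem one)
  qed (use surj var in \<open>simp_all add: \<psi>_simps \<theta>(2) \<psi>_mem\<close>)
  moreover have "m \<le> n"
    using card_mono [OF _ J] by (simp add: m_def)
  moreover have "vec_space.rank m (mat m n (\<lambda>(i, j). M i j)) = m"
  proof (rule rank_eq_dim_row)
    show "e k < n" if "k < m" for k using J eJ [OF that] by blast
    then show "mat m n (\<lambda>(i, j). M i j) $$ (i, e k) = (if i = k then 1 else 0)"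
      if "i < m" "k < m" for i k
      using that \<delta> [rule_format, OF eJ eJ, of i k] e_inj [of i k] by (simp add: M_def)
  qed simp
  ultimately show thesis
    using that [of m M] by (simp add: \<psi>_def)
qed

theorem theorem17:
  fixes A :: "('k::field, 'a) module"
    and A_gr :: "nat \<Rightarrow> 'a set"
    and B :: "'a set"
    and B_gr :: "nat \<Rightarrow> 'a set"
    and d n :: nat
    and F :: "'k mpol"
  assumes "standard_graded_algebra A A_gr"
    and "artinian_gorenstein A A_gr"
    and "has_socle_degree A A_gr d"
    and "CHAR('k) = 0 \<or> CHAR('k) > d"
    and "graded_subalgebra A A_gr B B_gr"
    and "B_gr 1 \<subseteq> A_gr 1"
    and "B = generated_subalgebra A (B_gr 1)"
    and "artinian_gorenstein (A\<lparr>carrier := B\<rparr>) B_gr"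
    and "has_socle_degree (A\<lparr>carrier := B\<rparr>) B_gr d"
    and "macaulay_dual_generator A A_gr d n F"
  shows "\<exists>m G. macaulay_dual_generator (A\<lparr>carrier := B\<rparr>) B_gr d m G
           \<and> obtained_by_linear_substitution n F m G"
proof -
  have A: "graded_algebra A A_gr"
    using assms(1) by (rule standard_graded_algebra.axioms(1))
  have B: "graded_algebra (A\<lparr>carrier := B\<rparr>) B_gr"
    using assms(5) by (simp add: graded_subalgebra_def)
  obtain \<theta> where F: "F \<in> homogeneous_component n d"
    and pres: "graded_presentation n \<theta> A A_gr"
    and ker: "\<And>f. f \<in> carrier (polynomial_algebra n) \<Longrightarrow> \<theta> f = \<zero>\<^bsub>A\<^esub> \<longleftrightarrow> diff_action f F = 0"
    using assms(10) unfolding macaulay_dual_generator_iff [OF A] by blast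
  obtain m M where m: "m \<le> n" and rank: "vec_space.rank m (mat m n (\<lambda>(i, j). M i j)) = m"
    and pres_B: "graded_presentation m (\<lambda>f. \<theta> (substitute (\<lambda>i. linear_form n (M i)) f))
      (A\<lparr>carrier := B\<rparr>) B_gr"
    by (rule subalgebra_presentation [OF A pres assms(5,7)])
  define G where "G = substitute (\<lambda>j. linear_form m (\<lambda>i. M i j)) F"
  have "\<theta> (substitute (\<lambda>i. linear_form n (M i)) f) = \<zero>\<^bsub>A\<lparr>carrier := B\<rparr>\<^esub> \<longleftrightarrow> diff_action f G = 0"
    if "f \<in> carrier (polynomial_algebra m)" for f
    unfolding G_def
  proof (rule annihilator_of_substitution [OF B assms(8,9) pres_B F _ that])
    fix g :: "'k mpol" assume "g \<in> carrier (polynomial_algebra m)"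
    then have "substitute (\<lambda>i. linear_form n (M i)) g \<in> carrier (polynomial_algebra n)"
      by (rule substitute_mem [OF _ linear_form_mem])
    from ker [OF this]
    show "\<theta> (substitute (\<lambda>i. linear_form n (M i)) g) = \<zero>\<^bsub>A\<lparr>carrier := B\<rparr>\<^esub> \<longleftrightarrow>
        diff_action (substitute (\<lambda>i. linear_form n (M i)) g) F = 0"
      by simp
  qed
  moreover have "G \<in> homogeneous_component m d"
    unfolding G_def by (rule substitute_homogeneous [OF F linear_form_homogeneous])
  ultimately have "macaulay_dual_generator (A\<lparr>carrier := B\<rparr>) B_gr d m G"
    unfolding macaulay_dual_generator_iff [OF B] using pres_B by blast
  moreover have "G = substitute (\<lambda>j. \<Sum>i<m. const_pol (mat m n (\<lambda>(i, j). M i j) $$ (i, j)) * var_pol i) F"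
    unfolding G_def
    by (rule substitute_cong [OF homogeneous_componentD [OF F]]) (simp add: linear_form_def)
  then have "obtained_by_linear_substitution n F m G"
    unfolding obtained_by_linear_substitution_def
    using m rank by (intro bexI [of _ "mat m n (\<lambda>(i, j). M i j)"]) simp_all
  ultimately show ?thesis by blast
qed

end
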